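(* Let $S=\pm\{0,1,x,x+1,2x+1\}\subseteq\mathbb{Z}[x]$. Let $A$ be a full row rank matrix with entries in $\mathbb{Z}[x]$ that has at least two non-zero maximal subdeterminants whose absolute values are distinct. Then $A$ is $S$-modular if and only if there exist a full row rank bimodular matrix $T$ and non-zero, non-parallel integer vectors $p,q$ such that $T/p$ and $T/q$ are unimodular and $A=T/(xp+(x+1)q)$.
   Context: For $X\subseteq\mathbb{Z}[x]$, $\pm X=X\cup(-X)$. The absolute value of $s\in\mathbb{Z}[x]$ is $|s|=s$ if $s=0$ or the leading coefficient of $s$ is positive, and $|s|=-s$ otherwise. For a full row rank $m\times n$ matrix ($m\le n$), its maximal subdeterminants are its $m\times m$ subdeterminants, and it is $S$-modular if all of them lie in $S$. A full row rank matrix is unimodular if all its maximal subdeterminants lie in $\{-1,0,1\}$; a full row rank integer matrix is bimodular if all its maximal subdeterminants lie in $\{-2,-1,0,1,2\}$. Non-parallel means linearly independent. Matrix projection: let $m,n\ge2$, let $T\in\mathbb{Q}(x)^{m\times n}$ have full row rank and let $w\in\mathbb{Q}(x)^m$ be non-zero. $T/w$ denotes any $(m-1)\times n$ matrix with entries in $\mathbb{Q}(x)$ such that $\det((T/w)_I)=\det(w\ \,T_I)$ for every $(m-1)$-element subset $I\subseteq[n]$, where the subscript $I$ denotes the submatrix of columns indexed by $I$ (in increasing order). Such a matrix exists and is unique up to left multiplication by a determinant-$1$ matrix; in particular its maximal subdeterminants, and hence whether it is unimodular, do not depend on the choice. Writing $A=T/w$ means that $A$ is one such representative. In the theorem, $T$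 has one more row than $A$ and the same number of columns. *)

theory Defs
  imports
    "Jordan_Normal_Form.DL_Rank_Submatrix"
    "HOL-Computational_Algebra.Polynomial_Factorial"
begin

(* The field of fractions of Z[x] is Q(x). *)
type_synonym ratfun = "int poly fract"

abbreviation var_x :: "int poly" where
  "var_x \<equiv> [:0, 1:]"

(* The library's absolute value on int poly is the one determined by the leading coefficient. *)
lemma abs_int_poly_lead_coeff:
  fixes s :: "int poly"
  shows "\<bar>s\<bar> = (if s = 0 \<or> lead_coeff s > 0 then s else - s)"
proof -
  have "s < 0 \<longleftrightarrow> lead_coeff s < 0"
    by (simp add: less_poly_def pos_poly_def)
  then show ?thesis
    by (auto simp: abs_poly_def)
qed

definition plus_minus :: "'a::uminus set \<Rightarrow> 'a set" where
  "plus_minus X = X \<union> uminus ` X"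

definition full_row_rank :: "'a::field mat \<Rightarrow> bool" where
  "full_row_rank A \<longleftrightarrow> vec_space.rank (dim_row A) A = dim_row A"

definition cols_submatrix :: "'a mat \<Rightarrow> nat set \<Rightarrow> 'a mat" where
  "cols_submatrix A I = submatrix A UNIV I"

definition max_subdets :: "'a::comm_ring_1 mat \<Rightarrow> 'a set" where
  "max_subdets A = {det (cols_submatrix A I) | I. I \<subseteq> {..<dim_col A} \<and> card I = dim_row A}"

(* To be used for matrices of full row rank only. *)
definition S_modular :: "'a::comm_ring_1 set \<Rightarrow> 'a mat \<Rightarrow> bool" where
  "S_modular S A \<longleftrightarrow> max_subdets A \<subseteq> S"

definition unimodular :: "'a::field mat \<Rightarrow> bool" where
  "unimodular A \<longleftrightarrow> full_row_rank A \<and> S_modular {-1, 0, 1} A"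

definition bimodular :: "int mat \<Rightarrow> bool" where
  "bimodular A \<longleftrightarrow> full_row_rank (map_mat rat_of_int A) \<and> S_modular {-2, -1, 0, 1, 2} A"

(* The explicit inequality is needed because lin_dep refers to the set {p, q}:
   a vector paired with itself is parallel. *)
definition non_parallel :: "nat \<Rightarrow> int vec \<Rightarrow> int vec \<Rightarrow> bool" where
  "non_parallel m p q \<longleftrightarrow> p \<noteq> q \<and>
     \<not> LinearCombinations.module.lin_dep class_ring (module_vec TYPE(rat) m)
         {map_vec rat_of_int p, map_vec rat_of_int q}"

(* The matrix (w T_I). *)
definition prepend_col :: "'a vec \<Rightarrow> 'a mat \<Rightarrow> 'a mat" where
  "prepend_col w T = mat_of_cols (dim_row T) (w # cols T)"

(* is_projection T w B: the matrix B is a representative of T/w, which is determined only up to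
   left multiplication by a matrix of determinant 1. *)
definition is_projection :: "ratfun mat \<Rightarrow> ratfun vec \<Rightarrow> ratfun mat \<Rightarrow> bool" where
  "is_projection T w B \<longleftrightarrow>
     2 \<le> dim_row T \<and> 2 \<le> dim_col T \<and> full_row_rank T \<and>
     w \<in> carrier_vec (dim_row T) \<and> w \<noteq> 0\<^sub>v (dim_row T) \<and>
     B \<in> carrier_mat (dim_row T - 1) (dim_col T) \<and>
     (\<forall>I. I \<subseteq> {..<dim_col T} \<and> card I = dim_row T - 1 \<longrightarrow>
        det (cols_submatrix B I) = det (prepend_col w (cols_submatrix T I)))"

abbreviation int_mat_to_ratfun :: "int mat \<Rightarrow> ratfun mat" where
  "int_mat_to_ratfun \<equiv> map_mat of_int"

abbreviation int_vec_to_ratfun :: "int vec \<Rightarrow> ratfun vec" where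
  "int_vec_to_ratfun \<equiv> map_vec of_int"

abbreviation poly_mat_to_ratfun :: "int poly mat \<Rightarrow> ratfun mat" where
  "poly_mat_to_ratfun \<equiv> map_mat to_fract"

end

theory Submission
  imports Defs "Subresultants.More_Homomorphisms"
begin

text \<open>
  The set \<open>S\<close> consists of the polynomials \<open>a x + b (x + 1)\<close> with \<open>\<bar>a\<bar>, \<bar>b\<bar> \<le> 1\<close>, so the backward
  direction is the linearity of \<open>det (w T\<^sub>J)\<close> in \<open>w\<close>. For the forward direction take a maximal square
  submatrix \<open>M\<close> of \<open>A\<close> with determinant \<open>\<delta> = a x + b (x + 1)\<close>, \<open>b = \<plusminus>1\<close>. The entries of
  \<open>D = adj(M) A\<close> are signed maximal subdeterminants of \<open>A\<close> (or zero), so \<open>D = x E + \<delta> N\<close> with integer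
  matrices \<open>E\<close> and \<open>N\<close>. The \<open>2 \<times> 2\<close> minors of \<open>D\<close> are \<open>\<delta>\<close> times elements of \<open>S\<close>, and comparing
  coefficients gives that \<open>E\<close> has rank at most one. It is non-zero because two subdeterminants have
  distinct absolute values, and its entries lie in \<open>{-2, \<dots>, 2}\<close>, so \<open>E = u v\<^sup>T\<close> with integer vectors \<open>u\<close>
  and \<open>v\<close>. Now \<open>T\<close> consists of the row \<open>v\<close> on top of \<open>N\<close>, and \<open>p = (a, -u)\<close>, \<open>q = (b, 0)\<close>.
  The matrices \<open>T/q\<close> and \<open>T/p\<close> are the evaluations of \<open>A\<close> at \<open>0\<close> and, up to sign, at \<open>-1\<close>.
\<close>

subsection \<open>Determinants of selected columns\<close>

text \<open>Functions as column indices admit repetitions and any order, so that exchanging column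
  \<open>i\<close> is the update \<open>f(i := j)\<close>.\<close>

definition select_cols :: "'a mat \<Rightarrow> nat \<Rightarrow> (nat \<Rightarrow> nat) \<Rightarrow> 'a mat" where
  "select_cols A r f = mat (dim_row A) r (\<lambda>(i, l). A $$ (i, f l))"

lemma dim_select_cols [simp]:
  "dim_row (select_cols A r f) = dim_row A" "dim_col (select_cols A r f) = r"
  by (simp_all add: select_cols_def)

lemma index_select_cols [simp]:
  "i < dim_row A \<Longrightarrow> l < r \<Longrightarrow> select_cols A r f $$ (i, l) = A $$ (i, f l)"
  by (simp add: select_cols_def)

lemma cols_submatrix_eq_select_cols:
  assumes "J \<subseteq> {..<dim_col A}"
  shows "cols_submatrix A J = select_cols A (card J) (pick J)"
proof -
  have "{j. j < dim_col A \<and> j \<in> J} = J"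
    using assms by auto
  then show ?thesis
    by (auto simp: cols_submatrix_def submatrix_def select_cols_def pick_UNIV)
qed

lemma bij_betw_pick:
  assumes "finite J"
  shows "bij_betw (pick J) {..<card J} J"
proof -
  have "inj_on (pick J) {..<card J}"
    by (rule linorder_inj_onI) (use pick_mono_le in force)+
  moreover have "pick J ` {..<card J} \<subseteq> J"
    using pick_in_set_le by auto
  ultimately show ?thesis
    using assms by (metis bij_betw_def card_image card_lessThan card_subset_eq)
qed

text \<open>\<open>pick J l\<close> is the element of \<open>J\<close> with exactly \<open>l\<close>
  smaller elements in \<open>J\<close>; here these are the values of \<open>h\<close> at arguments
  below \<open>l\<close>.\<close>

lemma pick_image_strict_mono:
  assumes h: "strict_mono_on {..<r} h" and l: "l < r"
  shows "pick (h ` {..<r}) l = h l"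
proof -
  have "{a \<in> h ` {..<r}. a < h l} = h ` {..<l}"
  proof -
    have "i < l" if "i < r" "h i < h l" for i
      using that strict_mono_onD[OF h, of l i] l by (metis lessThan_iff linorder_neqE_nat order.asym)
    moreover have "h i < h l" if "i < l" for i
      using that strict_mono_onD[OF h, of i l] l by simp
    ultimately show ?thesis
      using l by fastforce
  qed
  moreover have "inj_on h {..<l}"
    using strict_mono_on_imp_inj_on[OF h] l by (meson inj_on_subset lessThan_subset_iff less_imp_le)
  ultimately have "card {a \<in> h ` {..<r}. a < h l} = l"
    by (simp add: card_image)
  then show ?thesis
    using pick_card_in_set[of "h l" "h ` {..<r}"] l by auto
qed

lemma select_cols_strict_mono:
  assumes "strict_mono_on {..<r} h" "h ` {..<r} \<subseteq> {..<dim_col A}"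
  shows "select_cols A r h = cols_submatrix A (h ` {..<r})"
proof -
  have "card (h ` {..<r}) = r"
    using strict_mono_on_imp_inj_on[OF assms(1)] by (simp add: card_image)
  then show ?thesis
    using pick_image_strict_mono[OF assms(1)]
    by (intro eq_matI) (simp_all add: cols_submatrix_eq_select_cols[OF assms(2)])
qed

lemma det_select_cols_permutes:
  assumes A: "dim_row A = r" and p: "p permutes {..<r}"
  shows "det (select_cols A r (f \<circ> p)) = signof p * det (select_cols A r f)"
proof -
  let ?B = "select_cols A r f"
  have B: "?B \<in> carrier_mat r r" using A by auto
  have p': "p permutes {0..<r}" using p by (simp add: atLeast0LessThan)
  have "select_cols A r (f \<circ> p) = transpose_mat (mat r r (\<lambda>(i, j). transpose_mat ?B $$ (p i, j)))"
    using A permutes_in_image[OF p] by (intro eq_matI) auto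
  then have "det (select_cols A r (f \<circ> p)) = det (mat r r (\<lambda>(i, j). transpose_mat ?B $$ (p i, j)))"
    by (simp add: det_transpose[of _ r])
  also have "\<dots> = signof p * det (transpose_mat ?B)"
    using B by (intro det_permute_rows[OF _ p']) auto
  finally show ?thesis
    using det_transpose[OF B] by simp
qed

lemma det_select_cols_not_inj:
  assumes A: "dim_row A = r" and "\<not> inj_on f {..<r}"
  shows "det (select_cols A r f) = 0"
proof -
  obtain i j where "i < r" "j < r" "i \<noteq> j" "f i = f j"
    using assms(2) by (auto simp: inj_on_def)
  then show ?thesis
    using A by (intro det_identical_columns[of _ r i j]) (auto intro!: eq_vecI)
qed

text \<open>An injective \<open>f\<close> is the increasing enumeration of its image composed with a
  permutation, whose sign accounts for the two cases.\<close>

lemma det_select_cols_inj: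
  assumes A: "dim_row A = r" and f: "f ` {..<r} \<subseteq> {..<dim_col A}" "inj_on f {..<r}"
  shows "det (select_cols A r f) \<in>
    {det (cols_submatrix A (f ` {..<r})), - det (cols_submatrix A (f ` {..<r}))}"
proof -
  let ?J = "f ` {..<r}"
  have J: "card ?J = r" "finite ?J"
    using f by (auto simp: card_image)
  \<comment> \<open>Outside \<open>{..<r}\<close> the map is the identity, as
    \<open>permutes\<close> demands.\<close>
  define p where "p l = (if l < r then inv_into {..<r} (pick ?J) (f l) else l)" for l
  have bp: "bij_betw (pick ?J) {..<r} ?J"
    using bij_betw_pick[OF J(2)] J(1) by simp
  have "bij_betw f {..<r} ?J"
    using f by (simp add: bij_betw_def)
  from bij_betw_trans[OF this bij_betw_inv_into[OF bp]]
  have "bij_betw p {..<r} {..<r}"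
    by (rule bij_betw_cong[THEN iffD1, rotated]) (simp add: p_def)
  then have p: "p permutes {..<r}"
    by (rule bij_imp_permutes) (simp add: p_def)
  have "pick ?J (p l) = f l" if "l < r" for l
    using that bij_betw_inv_into_right[OF bp] by (simp add: p_def)
  then have "select_cols A r f = select_cols A r (pick ?J \<circ> p)"
    by (auto simp: select_cols_def)
  then have "det (select_cols A r f) = signof p * det (cols_submatrix A ?J)"
    using det_select_cols_permutes[OF A p] J(1) by (simp add: cols_submatrix_eq_select_cols[OF f(1)])
  then show ?thesis
    by (auto simp: sign_def)
qed

text \<open>Extends bounds on sorted column sets to all selections: a repeated column gives 0, a
  reordering only a sign.\<close>

lemma det_select_cols_in_max_subdets:
  assumes A: "dim_row A = r" and f: "f ` {..<r} \<subseteq> {..<dim_col A}"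
  shows "det (select_cols A r f) \<in> {0} \<union> max_subdets A \<union> uminus ` max_subdets A"
proof (cases "inj_on f {..<r}")
  case True
  then have "det (cols_submatrix A (f ` {..<r})) \<in> max_subdets A"
    using A f by (auto simp: max_subdets_def card_image)
  then show ?thesis
    using det_select_cols_inj[OF A f True] by auto
next
  case False
  then show ?thesis
    using det_select_cols_not_inj[OF A] by blast
qed

section \<open>Full row rank from a non-zero maximal minor\<close>

lemma rank_le_dim_row: "vec_space.rank (dim_row A) A \<le> dim_row A"
proof -
  interpret vec_space "TYPE('a)" "dim_row A" .
  have "set (cols A) \<subseteq> carrier_vec (dim_row A)"
    using cols_dim by blast
  then have "VectorSpace.subspace class_ring (span (set (cols A))) V"
    using span_is_subspace by simp
  from subspace_dim[OF this fin_dim fin_dim_span_cols[of A "dim_col A"]]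
  show ?thesis
    by (simp add: rank_def dim_is_n)
qed

lemma full_row_rank_if_minor:
  assumes J: "J \<subseteq> {..<dim_col A}" "card J = dim_row A" and "det (cols_submatrix A J) \<noteq> 0"
  shows "full_row_rank A"
proof -
  have "{j. j < dim_col A \<and> j \<in> J} = J"
    using J by auto
  then have "dim_row A \<le> vec_space.rank (dim_row A) A"
    using vec_space.rank_gt_minor[of A "dim_row A" "dim_col A" UNIV J] assms
    by (auto simp: cols_submatrix_def)
  moreover have "vec_space.rank (dim_row A) A \<le> dim_row A"
    by (rule rank_le_dim_row)
  ultimately show ?thesis
    by (simp add: full_row_rank_def)
qed

lemma cols_submatrix_map_mat:
  assumes "J \<subseteq> {..<dim_col A}"
  shows "cols_submatrix (map_mat h A) J = map_mat h (cols_submatrix A J)"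
proof -
  have "pick J l < dim_col A" if "l < card J" for l
    using assms pick_in_set_le[OF that] by auto
  then show ?thesis
    using assms by (auto simp: cols_submatrix_eq_select_cols intro!: eq_matI)
qed

lemma dim_cols_submatrix:
  assumes "J \<subseteq> {..<dim_col A}"
  shows "dim_row (cols_submatrix A J) = dim_row A" "dim_col (cols_submatrix A J) = card J"
  using assms by (simp_all add: cols_submatrix_eq_select_cols)

subsection \<open>Prepended columns\<close>

lemma dim_prepend_col [simp]:
  "dim_row (prepend_col w T) = dim_row T" "dim_col (prepend_col w T) = Suc (dim_col T)"
  by (simp_all add: prepend_col_def)

lemma index_prepend_col:
  "i < dim_row T \<Longrightarrow> j < Suc (dim_col T) \<Longrightarrow>
    prepend_col w T $$ (i, j) = (if j = 0 then w $ i else T $$ (i, j - 1))"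
  by (cases j) (auto simp: prepend_col_def mat_of_cols_index cols_nth)

lemma prepend_col_map_mat:
  assumes "dim_vec w = dim_row T"
  shows "prepend_col (map_vec h w) (map_mat h T) = map_mat h (prepend_col w T)"
  using assms by (auto simp: index_prepend_col intro!: eq_matI)

text \<open>Laplace expansion along the first column; \<open>insert_index i\<close> skips row
  \<open>i\<close>. The cofactors do not involve \<open>w\<close>, hence the linearity in
  \<open>w\<close> below.\<close>

lemma det_prepend_col:
  assumes T: "T \<in> carrier_mat (Suc r) r"
  shows "det (prepend_col w T) =
    (\<Sum>i<Suc r. w $ i * ((-1) ^ i * det (mat r r (\<lambda>(i', j). T $$ (insert_index i i', j)))))"
proof -
  have P: "prepend_col w T \<in> carrier_mat (Suc r) (Suc r)"
    using T by auto
  have "mat_delete (prepend_col w T) i 0 = mat r r (\<lambda>(i', j). T $$ (insert_index i i', j))"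
    if "i < Suc r" for i
    using T that by (auto simp: mat_delete_def index_prepend_col insert_index_def intro!: eq_matI)
  then show ?thesis
    using T unfolding laplace_expansion_column[OF P zero_less_Suc] cofactor_def
    by (intro sum.cong) (auto simp: index_prepend_col)
qed

lemma det_prepend_col_linear:
  assumes T: "T \<in> carrier_mat (Suc r) r"
    and "v \<in> carrier_vec (Suc r)" "w \<in> carrier_vec (Suc r)"
  shows "det (prepend_col (s \<cdot>\<^sub>v v + t \<cdot>\<^sub>v w) T) = s * det (prepend_col v T) + t * det (prepend_col w T)"
  using assms(2,3) unfolding det_prepend_col[OF T] sum_distrib_left sum.distrib[symmetric]
  by (intro sum.cong) (auto simp: algebra_simps)

text \<open>Expanding along column \<open>e\<close> or along the prepended column yields the same
  minors; the signs differ by \<open>(-1) ^ e\<close>.\<close>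

lemma det_replace_col:
  assumes M: "M \<in> carrier_mat (Suc r) (Suc r)" and e: "e < Suc r"
  shows "det (replace_col M w e) =
    (-1) ^ e * det (prepend_col w (select_cols M r (insert_index e)))"
proof -
  have R: "replace_col M w e \<in> carrier_mat (Suc r) (Suc r)"
    using M by (auto simp: replace_col_def)
  have S: "select_cols M r (insert_index e) \<in> carrier_mat (Suc r) r"
    using M by auto
  have "mat_delete (replace_col M w e) i e =
      mat r r (\<lambda>(i', j). select_cols M r (insert_index e) $$ (insert_index i i', j))"
    if "i < Suc r" for i
    using M that by (auto simp: mat_delete_def replace_col_def insert_index_def intro!: eq_matI)
  then have "det (replace_col M w e) = (\<Sum>i<Suc r. w $ i * ((-1) ^ (i + e) *
      det (mat r r (\<lambda>(i', j). select_cols M r (insert_index e) $$ (insert_index i i', j)))))"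
    using M e unfolding laplace_expansion_column[OF R e] cofactor_def
    by (intro sum.cong) (auto simp: replace_col_def)
  then show ?thesis
    unfolding det_prepend_col[OF S] by (simp add: sum_distrib_left power_add algebra_simps del: sum.lessThan_Suc)
qed

subsection \<open>Cramer's rule\<close>

lemma dim_replace_col [simp]:
  "dim_row (replace_col M w e) = dim_row M" "dim_col (replace_col M w e) = dim_col M"
  by (simp_all add: replace_col_def)

text \<open>Cramer's rule without division: the cofactors along column \<open>e\<close> ignore that
  column, so \<open>M\<close> and \<open>replace_col M w e\<close> share them.\<close>

lemma adj_mat_mult_vec_index:
  assumes M: "M \<in> carrier_mat m m" and w: "w \<in> carrier_vec m" and e: "e < m"
  shows "(adj_mat M *\<^sub>v w) $ e = det (replace_col M w e)"
proof -
  have R: "replace_col M w e \<in> carrier_mat m m"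
    using M by (auto simp: replace_col_def)
  have "mat_delete (replace_col M w e) i e = mat_delete M i e" for i
    using M e by (auto simp: mat_delete_def replace_col_def intro!: eq_matI)
  then have "det (replace_col M w e) = (\<Sum>i<m. w $ i * cofactor M i e)"
    using M e unfolding laplace_expansion_column[OF R e]
    by (intro sum.cong) (auto simp: replace_col_def cofactor_def)
  also have "\<dots> = (adj_mat M *\<^sub>v w) $ e"
    using M w e by (auto simp: adj_mat_def scalar_prod_def atLeast0LessThan mult.commute intro!: sum.cong)
  finally show ?thesis by simp
qed

lemma smult_mat_mult_vec:
  fixes A :: "'a::comm_semiring_0 mat"
  assumes "A \<in> carrier_mat m n" "v \<in> carrier_vec n"
  shows "(c \<cdot>\<^sub>m A) *\<^sub>v v = c \<cdot>\<^sub>v (A *\<^sub>v v)"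
  using assms by (auto simp: scalar_prod_def sum_distrib_left mult.assoc intro!: eq_vecI sum.cong)

lemma mult_mat_smult_vec:
  fixes A :: "'a::comm_semiring_0 mat"
  assumes "A \<in> carrier_mat m n" "v \<in> carrier_vec n"
  shows "A *\<^sub>v (c \<cdot>\<^sub>v v) = c \<cdot>\<^sub>v (A *\<^sub>v v)"
  using assms by (auto simp: scalar_prod_def sum_distrib_left mult.left_commute intro!: eq_vecI sum.cong)

lemma mult_adj_mat_vec:
  assumes M: "M \<in> carrier_mat m m" and w: "w \<in> carrier_vec m"
  shows "M *\<^sub>v (adj_mat M *\<^sub>v w) = det M \<cdot>\<^sub>v w" "adj_mat M *\<^sub>v (M *\<^sub>v w) = det M \<cdot>\<^sub>v w"
  using adj_mat[OF M] M w
  by (simp_all flip: assoc_mult_mat_vec[of _ m m _ m] add: smult_mat_mult_vec[of _ m m])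

text \<open>Let \<open>a'\<close> and \<open>b'\<close> be the vectors of Cramer numerators of \<open>p\<close> and \<open>q\<close>, and \<open>b' $ e = \<plusminus>1\<close>. The
  combination \<open>d\<close> of \<open>a'\<close> and \<open>b'\<close> that vanishes at \<open>e\<close> is mapped into \<open>det M \<cdot> \<int>\<^sup>m\<close> by the unimodular
  matrix \<open>replace_col M q e\<close>, so \<open>det M\<close> divides its entries, which have absolute value at most 2.\<close>
lemma abs_det_le_2_if_cramer_numerators:
  fixes M :: "int mat"
  assumes M: "M \<in> carrier_mat m m" and p: "p \<in> carrier_vec m" and q: "q \<in> carrier_vec m"
    and q0: "q \<noteq> 0\<^sub>v m" and pq: "\<And>c. p \<noteq> c \<cdot>\<^sub>v q"
    and a: "\<And>e. e < m \<Longrightarrow> \<bar>det (replace_col M p e)\<bar> \<le> 1"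
    and b: "\<And>e. e < m \<Longrightarrow> \<bar>det (replace_col M q e)\<bar> \<le> 1"
  shows "\<bar>det M\<bar> \<le> 2"
proof (cases "det M = 0")
  case False
  define a' where "a' = adj_mat M *\<^sub>v p"
  define b' where "b' = adj_mat M *\<^sub>v q"
  have adj: "adj_mat M \<in> carrier_mat m m"
    using adj_mat[OF M] by simp
  have carr: "a' \<in> carrier_vec m" "b' \<in> carrier_vec m"
    using adj p q by (auto simp: a'_def b'_def)
  have Ma: "M *\<^sub>v a' = det M \<cdot>\<^sub>v p" and Mb: "M *\<^sub>v b' = det M \<cdot>\<^sub>v q"
    using mult_adj_mat_vec[OF M] p q by (auto simp: a'_def b'_def)
  have a'_le: "\<bar>a' $ e\<bar> \<le> 1" if "e < m" for e
    using a[OF that] adj_mat_mult_vec_index[OF M p that] by (simp add: a'_def)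
  have b'_eq: "b' $ e = det (replace_col M q e)" if "e < m" for e
    using adj_mat_mult_vec_index[OF M q that] by (simp add: b'_def)
  have b'_le: "\<bar>b' $ e\<bar> \<le> 1" if "e < m" for e
    using b[OF that] b'_eq[OF that] by simp
  have "b' \<noteq> 0\<^sub>v m"
  proof
    assume "b' = 0\<^sub>v m"
    then have "det M \<cdot>\<^sub>v q = 0\<^sub>v m"
      using M by (simp flip: Mb) (auto intro!: eq_vecI)
    then have "det M * q $ i = 0" if "i < m" for i
      using that q by (metis carrier_vecD index_smult_vec(1) index_zero_vec(1))
    with False have "q = 0\<^sub>v m"
      using q by (intro eq_vecI) auto
    with q0 show False by simp
  qed
  then obtain e where e: "e < m" "b' $ e \<noteq> 0"
    using carr by (metis carrier_vecD eq_vecI index_zero_vec)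
  define \<beta> where "\<beta> = b' $ e"
  have \<beta>: "\<beta> * \<beta> = 1"
  proof -
    have "\<beta> = 1 \<or> \<beta> = -1"
      using e(2) b'_le[OF e(1)] unfolding \<beta>_def by linarith
    then show ?thesis by auto
  qed
  \<comment> \<open>As \<open>\<beta> * \<beta> = 1\<close>, subtracting \<open>c\<close> times
    \<open>b'\<close> cancels entry \<open>e\<close> of \<open>a'\<close>.\<close>
  define c where "c = a' $ e * \<beta>"
  define d where "d = a' - c \<cdot>\<^sub>v b'"
  define r where "r = p - c \<cdot>\<^sub>v q"
  define Q where "Q = replace_col M q e"
  have d: "d \<in> carrier_vec m" and r: "r \<in> carrier_vec m" and Q: "Q \<in> carrier_mat m m"
    using carr p q M by (auto simp: d_def r_def Q_def replace_col_def)
  have de: "d $ e = 0"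
    using e carr \<beta> by (simp add: d_def c_def \<beta>_def mult.assoc)
  have "M *\<^sub>v d = det M \<cdot>\<^sub>v r"
  proof -
    have "M *\<^sub>v d = M *\<^sub>v a' - c \<cdot>\<^sub>v (M *\<^sub>v b')"
      using M carr by (simp add: d_def mult_minus_distrib_mat_vec[of _ m m] mult_mat_smult_vec[of _ m m])
    then show ?thesis
      using p q by (auto simp: Ma Mb r_def algebra_simps intro!: eq_vecI)
  qed
  \<comment> \<open>\<open>Q\<close> and \<open>M\<close> differ only in column \<open>e\<close>,
    which meets the entry \<open>d $ e = 0\<close>.\<close>
  moreover have "Q *\<^sub>v d = M *\<^sub>v d"
    using M d de by (auto simp: Q_def replace_col_def scalar_prod_def intro!: eq_vecI sum.cong)
  ultimately have Qd: "Q *\<^sub>v d = det M \<cdot>\<^sub>v r"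
    by simp
  have detQ: "det Q = \<beta>"
    using b'_eq[OF e(1)] by (simp add: Q_def \<beta>_def)
  have "d \<noteq> 0\<^sub>v m"
  proof
    assume "d = 0\<^sub>v m"
    then have "det M \<cdot>\<^sub>v r = 0\<^sub>v m"
      using Q by (simp flip: Qd) (auto intro!: eq_vecI)
    then have "det M * r $ i = 0" if "i < m" for i
      using that r by (metis carrier_vecD index_smult_vec(1) index_zero_vec(1))
    with False have "r $ i = 0" if "i < m" for i
      using that by simp
    then have "p = c \<cdot>\<^sub>v q"
      using p q by (intro eq_vecI) (auto simp: r_def)
    with pq show False by blast
  qed
  then obtain h where h: "h < m" "d $ h \<noteq> 0"
    using d by (metis carrier_vecD eq_vecI index_zero_vec)
  \<comment> \<open>Since \<open>det Q = \<beta>\<close> is a unit, applying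
    \<open>adj_mat Q\<close> to \<open>Qd\<close> writes \<open>d\<close>, up to sign, as
    \<open>det M\<close> times an integer vector.\<close>
  have "\<beta> \<cdot>\<^sub>v d = adj_mat Q *\<^sub>v (det M \<cdot>\<^sub>v r)"
    using mult_adj_mat_vec(2)[OF Q d] Qd detQ by simp
  also have "\<dots> = det M \<cdot>\<^sub>v (adj_mat Q *\<^sub>v r)"
    using adj_mat(1)[OF Q] r by (simp add: mult_mat_smult_vec[of _ m m])
  finally have "\<beta> * d $ h = det M * (adj_mat Q *\<^sub>v r) $ h"
    using h d adj_mat(1)[OF Q] by (metis carrier_matD(1) carrier_vecD dim_mult_mat_vec index_smult_vec(1))
  then have "det M dvd \<beta> * d $ h"
    by simp
  then have "det M dvd \<beta> * (\<beta> * d $ h)"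
    by (rule dvd_mult)
  then have "det M dvd d $ h"
    using \<beta> by (simp flip: mult.assoc)
  then have "\<bar>det M\<bar> \<le> \<bar>d $ h\<bar>"
    using h dvd_imp_le_int by blast
  also have "\<dots> \<le> \<bar>a' $ h\<bar> + \<bar>c\<bar> * \<bar>b' $ h\<bar>"
    using h carr by (simp add: d_def abs_triangle_ineq4 flip: abs_mult)
  also have "\<dots> \<le> 1 + 1 * 1"
    using a'_le[OF h(1)] b'_le[OF h(1)] a'_le[OF e(1)] b'_le[OF e(1)]
    by (intro add_mono mult_mono) (auto simp: c_def \<beta>_def abs_mult intro: mult_le_one)
  finally show ?thesis by simp
qed simp

text \<open>Dependence of the set of two vectors becomes a non-trivial kernel of the matrix with
  these columns, which can be tested by coordinates.\<close>

lemma non_parallelI: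
  assumes p: "p \<in> carrier_vec m" and q: "q \<in> carrier_vec m"
    and indep: "\<And>s t :: rat. (\<And>i. i < m \<Longrightarrow> s * of_int (p $ i) + t * of_int (q $ i) = 0) \<Longrightarrow> s = 0 \<and> t = 0"
  shows "non_parallel m p q"
proof -
  have pq: "p \<noteq> q"
    using indep[of 1 "-1"] by auto
  let ?p = "map_vec rat_of_int p" and ?q = "map_vec rat_of_int q"
  let ?A = "mat_of_cols m [?p, ?q]"
  have carr: "set [?p, ?q] \<subseteq> carrier_vec m" "?A \<in> carrier_mat m 2"
    using p q by (auto simp: mat_of_cols_def)
  have cols: "cols ?A = [?p, ?q]"
    by (rule cols_mat_of_cols[OF carr(1)])
  have "?p \<noteq> ?q"
    using pq p q by (metis of_int_hom.vec_hom_inj)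
  then have dist: "distinct (cols ?A)"
    by (simp add: cols)
  have "\<not> LinearCombinations.module.lin_dep class_ring (module_vec TYPE(rat) m) (set (cols ?A))"
  proof
    assume "LinearCombinations.module.lin_dep class_ring (module_vec TYPE(rat) m) (set (cols ?A))"
    from vec_space.lin_depE[OF carr(2) this dist]
    obtain v where v: "v \<in> carrier_vec 2" "v \<noteq> 0\<^sub>v 2" "?A *\<^sub>v v = 0\<^sub>v m" by blast
    have "v $ 0 * of_int (p $ i) + v $ 1 * of_int (q $ i) = 0" if "i < m" for i
    proof -
      have "(?A *\<^sub>v v) $ i = 0"
        using v that by simp
      then show ?thesis
        using that p q v(1) carr(2)
        by (simp add: scalar_prod_def numeral_2_eq_2 mat_of_cols_index mult.commute)
    qed
    from indep[OF this] have "v = 0\<^sub>v 2"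
      using v(1) by (intro eq_vecI) (auto simp: less_2_cases_iff)
    with v(2) show False by simp
  qed
  then show ?thesis
    using pq by (simp add: non_parallel_def cols)
qed

section \<open>Exchanging columns in a selection\<close>

lemma col_select_cols:
  "l < r \<Longrightarrow> f l < dim_col A \<Longrightarrow> col (select_cols A r f) l = col A (f l)"
  by (auto intro!: eq_vecI)

lemma mult_mat_unit_vec:
  fixes M :: "'a::semiring_1 mat"
  assumes "M \<in> carrier_mat m n" "i < n"
  shows "M *\<^sub>v unit_vec n i = col M i"
  using assms by (auto intro!: eq_vecI)

text \<open>Through this identity the Cramer numerators of the columns of \<open>A\<close> are
  selection determinants of \<open>A\<close> again.\<close>

lemma replace_col_select_cols:
  assumes "j < dim_col A"
  shows "replace_col (select_cols A r f) (col A j) i = select_cols A r (f(i := j))"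
  using assms by (auto simp: replace_col_def intro!: eq_matI)

lemma replace_col_mult_vec_zero:
  assumes "M \<in> carrier_mat m m" "d \<in> carrier_vec m" "d $ e = 0"
  shows "replace_col M b e *\<^sub>v d = M *\<^sub>v d"
  using assms by (auto simp: replace_col_def scalar_prod_def intro!: eq_vecI sum.cong)

text \<open>The vector \<open>w\<close> in the proof solves \<open>M' w = det M \<cdot> D i j \<cdot> col A l\<close>, where \<open>M'\<close> is the selection with
  column \<open>i\<close> exchanged; Cramer's rule for this system is the claim.\<close>
lemma det_exchange_two_cols:
  fixes A :: "'a::idom mat"
  assumes A: "A \<in> carrier_mat k n" and f: "f ` {..<k} \<subseteq> {..<n}"
    and i: "i < k" "i' < k" "i \<noteq> i'" and j: "j < n" "l < n"
    and D: "\<And>i j. D i j = det (select_cols A k (f(i := j)))"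
    and nz: "D i j \<noteq> 0"
  shows "D i j * D i' l - D i l * D i' j =
    det (select_cols A k f) * det (select_cols A k (f(i := j, i' := l)))"
proof -
  define M where "M = select_cols A k f"
  define y z where "y = adj_mat M *\<^sub>v col A j" and "z = adj_mat M *\<^sub>v col A l"
  define M' where "M' = select_cols A k (f(i := j))"
  define u where "u = D i j \<cdot>\<^sub>v z - D i l \<cdot>\<^sub>v y"
  \<comment> \<open>\<open>M'\<close> sends \<open>unit_vec k i\<close> to \<open>col A j\<close>,
    so this multiple cancels the term in \<open>col A j\<close> of the image of
    \<open>u\<close>.\<close>
  define c where "c = det M * D i l"
  define w where "w = u + c \<cdot>\<^sub>v unit_vec k i"
  have M: "M \<in> carrier_mat k k" and M': "M' \<in> carrier_mat k k"
    using A by (auto simp: M_def M'_def)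
  have cA: "col A j' \<in> carrier_vec k" for j'
    using A by auto
  have yz: "y \<in> carrier_vec k" "z \<in> carrier_vec k"
    using adj_mat(1)[OF M] cA by (auto simp: y_def z_def)
  have D_index: "(adj_mat M *\<^sub>v col A j') $ e = D e j'" if "e < k" "j' < n" for e j'
    using A adj_mat_mult_vec_index[OF M cA that(1)] that
    by (simp add: M_def D replace_col_select_cols)
  have index: "y $ e = D e j" "z $ e = D e l" if "e < k" for e
    using D_index that j by (simp_all add: y_def z_def)
  have u: "u \<in> carrier_vec k" "u $ i = 0"
    using yz i index by (auto simp: u_def)
  have w: "w \<in> carrier_vec k"
    using u by (auto simp: w_def)
  have M'_eq: "M' = replace_col M (col A j) i"
    using A j by (simp add: M_def M'_def replace_col_select_cols)
  have "M *\<^sub>v u = D i j \<cdot>\<^sub>v (det M \<cdot>\<^sub>v col A l) - D i l \<cdot>\<^sub>v (det M \<cdot>\<^sub>v col A j)"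
    using M yz mult_adj_mat_vec(1)[OF M cA]
    by (simp add: u_def y_def z_def mult_minus_distrib_mat_vec[of _ k k] mult_mat_smult_vec[of _ k k])
  moreover have "M' *\<^sub>v u = M *\<^sub>v u"
    unfolding M'_eq by (rule replace_col_mult_vec_zero[OF M u])
  moreover have "M' *\<^sub>v unit_vec k i = col A j"
    using M' i A j col_select_cols[of i k "f(i := j)" A] by (simp add: mult_mat_unit_vec[of _ k k] M'_def)
  moreover have "M' *\<^sub>v w = M' *\<^sub>v u + c \<cdot>\<^sub>v (M' *\<^sub>v unit_vec k i)"
    using M' u by (simp add: w_def mult_add_distrib_mat_vec[of _ k k] mult_mat_smult_vec[of _ k k])
  ultimately have M'w: "M' *\<^sub>v w = (det M * D i j) \<cdot>\<^sub>v col A l"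
    using A cA by (auto simp: c_def algebra_simps intro!: eq_vecI)
  have detM': "det M' = D i j"
    by (simp add: M'_def D)
  have "D i j \<cdot>\<^sub>v w = (det M * D i j) \<cdot>\<^sub>v (adj_mat M' *\<^sub>v col A l)"
    using mult_adj_mat_vec(2)[OF M' w] M'w adj_mat(1)[OF M'] cA detM'
    by (simp add: mult_mat_smult_vec[of _ k k])
  then have "(D i j \<cdot>\<^sub>v w) $ i' = ((det M * D i j) \<cdot>\<^sub>v (adj_mat M' *\<^sub>v col A l)) $ i'"
    by simp
  then have "D i j * w $ i' = det M * D i j * (adj_mat M' *\<^sub>v col A l) $ i'"
    using w i adj_mat(1)[OF M'] by simp
  moreover have "(adj_mat M' *\<^sub>v col A l) $ i' = det (select_cols A k (f(i := j, i' := l)))"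
    using A j adj_mat_mult_vec_index[OF M' cA i(2)] by (simp add: M'_def replace_col_select_cols)
  moreover have "w $ i' = D i j * D i' l - D i l * D i' j"
    using i u yz index by (simp add: w_def u_def)
  ultimately have "D i j * (D i j * D i' l - D i l * D i' j) =
      D i j * (det M * det (select_cols A k (f(i := j, i' := l))))"
    by (simp add: mult_ac)
  then show ?thesis
    using nz by (simp add: M_def)
qed

text \<open>The bound 2 matters: entries 2 and 3 in one column would prevent an integral
  factorization through a row of \<open>E\<close>. The normalization \<open>u i0 = 1\<close> later
  makes \<open>p\<close> non-zero below its first entry.\<close>

lemma rank_one_factorization:
  fixes E :: "nat \<Rightarrow> nat \<Rightarrow> int"
  assumes minors: "\<And>i i' j j'. i < k \<Longrightarrow> i' < k \<Longrightarrow> j < n \<Longrightarrow> j' < n \<Longrightarrow> E i j * E i' j' = E i j' * E i' j"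
    and le: "\<And>i j. i < k \<Longrightarrow> j < n \<Longrightarrow> \<bar>E i j\<bar> \<le> 2"
    and nz: "i1 < k" "j1 < n" "E i1 j1 \<noteq> 0"
  shows "\<exists>u i0. i0 < k \<and> u i0 = 1 \<and> E i0 j1 \<noteq> 0 \<and> (\<forall>i<k. \<forall>j<n. E i j = u i * E i0 j)"
proof -
  \<comment> \<open>A non-zero entry of smallest absolute value in column \<open>j1\<close> divides that column, as all entries
    are at most 2 in absolute value.\<close>
  define X where "X = {i. i < k \<and> E i j1 \<noteq> 0}"
  obtain i0 where "i0 \<in> X" "\<And>i. i \<in> X \<Longrightarrow> nat \<bar>E i0 j1\<bar> \<le> nat \<bar>E i j1\<bar>"
    using ex_has_least_nat[of "\<lambda>i. i \<in> X" i1 "\<lambda>i. nat \<bar>E i j1\<bar>"] nz by (auto simp: X_def)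
  then have i0: "i0 \<in> X" "\<And>i. i \<in> X \<Longrightarrow> \<bar>E i0 j1\<bar> \<le> \<bar>E i j1\<bar>"
    by (auto simp: nat_le_iff)
  define u where "u i = E i j1 div E i0 j1" for i
  have u: "E i j1 = u i * E i0 j1" if "i < k" for i
  proof (cases "E i j1 = 0")
    case False
    then have "1 \<le> \<bar>E i0 j1\<bar>" "\<bar>E i0 j1\<bar> \<le> \<bar>E i j1\<bar>" "\<bar>E i j1\<bar> \<le> 2"
      using i0 that le nz by (auto simp: X_def)
    then have "\<bar>E i0 j1\<bar> = 1 \<or> \<bar>E i0 j1\<bar> = \<bar>E i j1\<bar>"
      by linarith
    then have "E i0 j1 dvd E i j1"
      by (metis abs_dvd_iff dvd_abs_iff dvd_refl one_dvd)
    then show ?thesis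
      by (simp add: u_def)
  qed (simp add: u_def)
  \<comment> \<open>The vanishing minors through row \<open>i0\<close> and column \<open>j1\<close>
    carry the factor \<open>u i\<close> from column \<open>j1\<close> to every column.\<close>
  have E: "E i j = u i * E i0 j" if "i < k" "j < n" for i j
  proof -
    have "E i0 j1 * E i j = E i0 j1 * (u i * E i0 j)"
      using minors[of i0 i j1 j] i0(1) that nz u[OF that(1)] by (simp add: X_def mult_ac)
    then show ?thesis
      using i0(1) by (simp add: X_def)
  qed
  have "u i0 = 1" "i0 < k" "E i0 j1 \<noteq> 0"
    using i0(1) by (simp_all add: u_def X_def)
  then show ?thesis
    by (intro exI[of _ u] exI[of _ i0] conjI allI impI E)
qed

subsection \<open>Construction of the lift\<close>

lemma pCons_plus_1: "pCons a p + 1 = pCons (a + 1) p" for a :: "'a::comm_semiring_1"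
  by (metis add_pCons one_pCons add.right_neutral)

text \<open>Evaluation at 0 returns \<open>b\<close> and evaluation at -1 returns
  \<open>- a\<close>; coordinates are read off this way later.\<close>

lemma int_poly_eq_coordinates: "[:b, a + b:] = var_x * of_int a + (var_x + 1) * of_int b"
  for a b :: int
  unfolding pCons_plus_1 by (simp add: of_int_poly)

text \<open>Up to sign, equal non-zero coordinates give \<open>2 * var_x + 1\<close>, opposite ones
  give 1, and a single non-zero one gives \<open>var_x\<close> or \<open>var_x + 1\<close>.\<close>

lemma plus_minus_coordinates:
  "plus_minus {0, 1, var_x, var_x + 1, 2 * var_x + 1} =
    (\<lambda>(a, b). [:b, a + b:]) ` ({-1, 0, 1} \<times> {-1, 0, 1})"
proof -
  have "2 * var_x + 1 = [:1, 2:]"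
    by (simp add: numeral_poly pCons_plus_1)
  then show ?thesis
    unfolding pCons_plus_1 by (auto simp: plus_minus_def image_iff)
qed

text \<open>The choice of \<open>c\<close> matches the constant terms, so that the remainder is a
  multiple of x.\<close>

lemma coordinates_decomposition:
  fixes a b \<alpha> \<beta> c :: int
  assumes "b * c = \<beta>"
  shows "[:\<beta>, \<alpha> + \<beta>:] = var_x * of_int (\<alpha> - a * c) + [:b, a + b:] * of_int c"
  unfolding assms[symmetric] by (simp add: of_int_poly) (simp add: algebra_simps)

text \<open>The hypothesis is quadratic in \<open>x\<close>, so evaluation at \<open>0\<close>, \<open>-1\<close> and \<open>1\<close> captures it.\<close>
lemma minor_of_perturbation:
  fixes a b a' b' :: int
  assumes eq: "[:\<beta>\<^sub>1, \<alpha>\<^sub>1 + \<beta>\<^sub>1:] * [:\<beta>\<^sub>2, \<alpha>\<^sub>2 + \<beta>\<^sub>2:] - [:\<beta>\<^sub>3, \<alpha>\<^sub>3 + \<beta>\<^sub>3:] * [:\<beta>\<^sub>4, \<alpha>\<^sub>4 + \<beta>\<^sub>4:] =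
      [:b, a + b:] * [:b', a' + b':]"
    and b: "b * b = 1"
  shows "(\<alpha>\<^sub>1 - a * (b * \<beta>\<^sub>1)) * (\<alpha>\<^sub>2 - a * (b * \<beta>\<^sub>2)) = (\<alpha>\<^sub>3 - a * (b * \<beta>\<^sub>3)) * (\<alpha>\<^sub>4 - a * (b * \<beta>\<^sub>4))"
proof -
  have at0: "\<beta>\<^sub>1 * \<beta>\<^sub>2 - \<beta>\<^sub>3 * \<beta>\<^sub>4 = b * b'"
    using arg_cong[OF eq, of "\<lambda>s. poly s 0"] by (simp add: mult.commute)
  have at_minus_1: "\<alpha>\<^sub>1 * \<alpha>\<^sub>2 - \<alpha>\<^sub>3 * \<alpha>\<^sub>4 = a * a'"
    using arg_cong[OF eq, of "\<lambda>s. poly s (-1)"] by (simp only: poly_diff poly_mult poly_pCons) simp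
  have at_1: "(\<alpha>\<^sub>1 + 2 * \<beta>\<^sub>1) * (\<alpha>\<^sub>2 + 2 * \<beta>\<^sub>2) - (\<alpha>\<^sub>3 + 2 * \<beta>\<^sub>3) * (\<alpha>\<^sub>4 + 2 * \<beta>\<^sub>4) = (a + 2 * b) * (a' + 2 * b')"
    using arg_cong[OF eq, of "\<lambda>s. poly s 1"] by (simp only: poly_diff poly_mult poly_pCons) (simp add: algebra_simps)
  \<comment> \<open>\<open>at_1\<close> minus \<open>at_minus_1\<close> minus four times
    \<open>at0\<close> is twice this equation.\<close>
  have mixed: "\<alpha>\<^sub>1 * \<beta>\<^sub>2 + \<beta>\<^sub>1 * \<alpha>\<^sub>2 - \<alpha>\<^sub>3 * \<beta>\<^sub>4 - \<beta>\<^sub>3 * \<alpha>\<^sub>4 = a * b' + b * a'"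
    using at0 at_minus_1 at_1 by (simp add: algebra_simps)
  \<comment> \<open>This is the binary quadratic form with coefficients from
    \<open>at_minus_1\<close>, \<open>mixed\<close> and \<open>at0\<close>, evaluated at
    \<open>(1, - a * b)\<close>. The form factors as \<open>(a X + b Y) (a' X + b' Y)\<close>, and
    the first factor vanishes there since \<open>b * b = 1\<close>.\<close>
  have "(\<alpha>\<^sub>1 - a * (b * \<beta>\<^sub>1)) * (\<alpha>\<^sub>2 - a * (b * \<beta>\<^sub>2)) - (\<alpha>\<^sub>3 - a * (b * \<beta>\<^sub>3)) * (\<alpha>\<^sub>4 - a * (b * \<beta>\<^sub>4)) =
      (\<alpha>\<^sub>1 * \<alpha>\<^sub>2 - \<alpha>\<^sub>3 * \<alpha>\<^sub>4) - a * b * (\<alpha>\<^sub>1 * \<beta>\<^sub>2 + \<beta>\<^sub>1 * \<alpha>\<^sub>2 - \<alpha>\<^sub>3 * \<beta>\<^sub>4 - \<beta>\<^sub>3 * \<alpha>\<^sub>4)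
      + a * a * (b * b) * (\<beta>\<^sub>1 * \<beta>\<^sub>2 - \<beta>\<^sub>3 * \<beta>\<^sub>4)"
    by (simp add: algebra_simps)
  also have "\<dots> = a * a' * (1 - b * b) + a * a * b * b' * (b * b - 1)"
    unfolding at0 at_minus_1 mixed by (simp add: algebra_simps)
  also have "\<dots> = 0"
    by (simp add: b)
  finally show ?thesis by simp
qed

text \<open>As \<open>b\<close> is a unit, each exchanged determinant can be divided by
  \<open>[:b, a + b:]\<close> with a multiple of x as remainder. The minors of \<open>E\<close>
  vanish because those of the exchange matrix are divisible by \<open>[:b, a + b:]\<close>.\<close>

lemma exchange_matrix_decomposition:
  fixes A :: "int poly mat"
  assumes A: "A \<in> carrier_mat k n" and f: "f ` {..<k} \<subseteq> {..<n}"
    and S: "\<And>g. g ` {..<k} \<subseteq> {..<n} \<Longrightarrow>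
      \<exists>a b. \<bar>a\<bar> \<le> 1 \<and> \<bar>b\<bar> \<le> 1 \<and> det (select_cols A k g) = [:b, a + b:]"
    and \<delta>: "det (select_cols A k f) = [:b, a + b:]" and a: "\<bar>a\<bar> \<le> 1" and b: "b * b = 1"
  obtains E N :: "nat \<Rightarrow> nat \<Rightarrow> int" where
    "\<And>i j. i < k \<Longrightarrow> j < n \<Longrightarrow>
      det (select_cols A k (f(i := j))) = var_x * of_int (E i j) + [:b, a + b:] * of_int (N i j)"
    "\<And>i j. i < k \<Longrightarrow> j < n \<Longrightarrow> \<bar>E i j\<bar> \<le> 2"
    "\<And>i i' j l. i < k \<Longrightarrow> i' < k \<Longrightarrow> j < n \<Longrightarrow> l < n \<Longrightarrow> E i j * E i' l = E i l * E i' j"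
proof -
  define D where "D i j = det (select_cols A k (f(i := j)))" for i j
  define \<alpha> \<beta> where "\<alpha> i j = - poly (D i j) (-1)" and "\<beta> i j = poly (D i j) 0" for i j
  define N where "N i j = b * \<beta> i j" for i j
  define E where "E i j = \<alpha> i j - a * N i j" for i j
  have D: "D i j = [:\<beta> i j, \<alpha> i j + \<beta> i j:] \<and> \<bar>\<alpha> i j\<bar> \<le> 1 \<and> \<bar>\<beta> i j\<bar> \<le> 1" if "i < k" "j < n" for i j
  proof -
    have "(f(i := j)) ` {..<k} \<subseteq> {..<n}"
      using f that by auto
    from S[OF this] show ?thesis
      by (auto simp: \<alpha>_def \<beta>_def D_def)
  qed
  have "D i j = var_x * of_int (E i j) + [:b, a + b:] * of_int (N i j)" if "i < k" "j < n" for i j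
  proof -
    have "b * N i j = \<beta> i j"
      using b by (simp add: N_def flip: mult.assoc)
    then show ?thesis
      unfolding E_def D[OF that, THEN conjunct1] by (rule coordinates_decomposition)
  qed
  moreover have "\<bar>E i j\<bar> \<le> 2" if "i < k" "j < n" for i j
  proof -
    have "\<bar>b\<bar> = 1"
      using b zmult_eq_1_iff[of b b] by auto
    then have "\<bar>a * N i j\<bar> \<le> 1"
      using a D[OF that] by (simp add: N_def abs_mult mult_le_one)
    then show ?thesis
      using D[OF that] unfolding E_def by linarith
  qed
  moreover have "E i j * E i' l = E i l * E i' j"
    if ii: "i < k" "i' < k" and jl: "j < n" "l < n" for i i' j l
  proof (cases "i = i'")
    case False
    have minor: "E i j * E i' l = E i l * E i' j"
      if ii: "i < k" "i' < k" "i \<noteq> i'" and jl: "j < n" "l < n" and nz: "D i j \<noteq> 0" for i i' j l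
    proof -
      have "(f(i := j, i' := l)) ` {..<k} \<subseteq> {..<n}"
        using f ii jl by auto
      from S[OF this] obtain a' b' where
        P: "det (select_cols A k (f(i := j, i' := l))) = [:b', a' + b':]" by blast
      have eq: "D i j * D i' l - D i l * D i' j = [:b, a + b:] * [:b', a' + b':]"
        using det_exchange_two_cols[OF A f ii jl D_def nz] by (simp only: \<delta> P)
      have D': "D i j = [:\<beta> i j, \<alpha> i j + \<beta> i j:]" "D i' l = [:\<beta> i' l, \<alpha> i' l + \<beta> i' l:]"
        "D i l = [:\<beta> i l, \<alpha> i l + \<beta> i l:]" "D i' j = [:\<beta> i' j, \<alpha> i' j + \<beta> i' j:]"
        using D ii jl by auto
      show ?thesis
        unfolding E_def N_def by (rule minor_of_perturbation[OF eq[unfolded D'] b])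
    qed
    \<comment> \<open>\<open>det_exchange_two_cols\<close> asks for a non-zero pivot. By symmetry
      each of the four entries can be the pivot, and if all vanish then so do the entries of
      \<open>E\<close>.\<close>
    consider "D i j \<noteq> 0" | "D i' l \<noteq> 0" | "D i l \<noteq> 0" | "D i' j \<noteq> 0" |
      "D i j = 0" "D i' l = 0" "D i l = 0" "D i' j = 0" by blast
    then show ?thesis
    proof cases
      case 5
      then show ?thesis by (simp add: E_def N_def \<alpha>_def \<beta>_def)
    next
      case 1
      then show ?thesis by (intro minor ii jl False)
    next
      case 2
      then have "E i' l * E i j = E i' j * E i l" by (intro minor ii jl False[symmetric])
      then show ?thesis by (metis mult.commute)
    next
      case 3
      then have "E i l * E i' j = E i j * E i' l" by (intro minor ii jl False)
      then show ?thesis by simp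
    next
      case 4
      then have "E i' j * E i l = E i' l * E i j" by (intro minor ii jl False[symmetric])
      then show ?thesis by (metis mult.commute)
    qed
  qed (simp add: mult.commute)
  ultimately show thesis
    using that[of E N] by (simp add: D_def)
qed

text \<open>Left multiplication by the block matrix with rows \<open>(1, 0)\<close> and \<open>(M U, \<delta> M)\<close>, where \<open>w = (\<delta>, -U)\<close>,
  annihilates the entries of \<open>w\<close> below \<open>\<delta> = det M\<close> and turns the lower right block into \<open>\<delta> A\<close>.\<close>
lemma det_prepend_col_lift:
  fixes A :: "'a::idom mat"
  assumes M: "M \<in> carrier_mat k k" and A: "A \<in> carrier_mat k k" and T: "T \<in> carrier_mat (Suc k) k"
    and nz: "det M \<noteq> 0"
    and w: "w \<in> carrier_vec (Suc k)" "w $ 0 = det M"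
    and D: "\<And>i j. i < k \<Longrightarrow> j < k \<Longrightarrow>
      (adj_mat M * A) $$ (i, j) = det M * T $$ (Suc i, j) - w $ Suc i * T $$ (0, j)"
  shows "det (prepend_col w T) = det A"
proof -
  define \<delta> where "\<delta> = det M"
  define U where "U = mat k 1 (\<lambda>(i, j). - w $ Suc i)"
  define V where "V = mat 1 k (\<lambda>(i, j). T $$ (0, j))"
  define N where "N = mat k k (\<lambda>(i, j). T $$ (Suc i, j))"
  define \<Delta> where "\<Delta> = \<delta> \<cdot>\<^sub>m 1\<^sub>m 1"
  define H where "H = four_block_mat (1\<^sub>m 1) (0\<^sub>m 1 k) (M * U) (\<delta> \<cdot>\<^sub>m M)"
  have carr: "U \<in> carrier_mat k 1" "V \<in> carrier_mat 1 k" "N \<in> carrier_mat k k" "\<Delta> \<in> carrier_mat 1 1"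
    "M * U \<in> carrier_mat k 1" "adj_mat M \<in> carrier_mat k k"
    using M adj_mat(1)[OF M] by (auto simp: U_def V_def N_def \<Delta>_def)
  have L: "prepend_col w T = four_block_mat \<Delta> V (- U) N"
    using T w by (auto simp: index_prepend_col U_def V_def N_def \<Delta>_def \<delta>_def intro!: eq_matI)
  have UVN: "U * V + \<delta> \<cdot>\<^sub>m N = adj_mat M * A"
    using D carr A by (intro eq_matI) (auto simp: U_def V_def N_def \<delta>_def scalar_prod_def)
  have "M * U * V + (\<delta> \<cdot>\<^sub>m M) * N = M * (U * V + \<delta> \<cdot>\<^sub>m N)"
    using M carr by (simp add: mult_add_distrib_mat[of _ k k _ k] mult_smult_distrib[of _ k k _ k]
      mult_smult_assoc_mat[of _ k k _ k] assoc_mult_mat[of _ k k _ 1 _ k])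
  also have "\<dots> = \<delta> \<cdot>\<^sub>m A"
    using adj_mat[OF M] M A unfolding UVN
    by (simp add: \<delta>_def mult_smult_assoc_mat[of _ k k _ k] flip: assoc_mult_mat[of _ k k _ k _ k])
  finally have LR: "M * U * V + (\<delta> \<cdot>\<^sub>m M) * N = \<delta> \<cdot>\<^sub>m A" .
  have "M * U * \<Delta> + (\<delta> \<cdot>\<^sub>m M) * (- U) = 0\<^sub>m k 1"
    using M carr by (auto simp: \<Delta>_def scalar_prod_def sum_distrib_left sum_negf mult_ac intro!: eq_matI)
  then have "H * prepend_col w T = four_block_mat \<Delta> V (0\<^sub>m k 1) (\<delta> \<cdot>\<^sub>m A)"
    unfolding L H_def using M carr LR
    by (subst mult_four_block_mat[of _ 1 1 _ k _ k _ _ 1 _ k]) auto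
  moreover have "det (four_block_mat \<Delta> V (0\<^sub>m k 1) (\<delta> \<cdot>\<^sub>m A)) = det \<Delta> * det (\<delta> \<cdot>\<^sub>m A)"
    using carr A by (intro det_four_block_mat_lower_left_zero) auto
  moreover have "det H = det (1\<^sub>m 1 :: 'a mat) * det (\<delta> \<cdot>\<^sub>m M)"
    unfolding H_def using carr M by (intro det_four_block_mat_upper_right_zero) auto
  moreover have "det (H * prepend_col w T) = det H * det (prepend_col w T)"
    using M T by (intro det_mult[of _ "Suc k"]) (auto simp: H_def)
  ultimately have "det (1\<^sub>m 1 :: 'a mat) * det (\<delta> \<cdot>\<^sub>m M) * det (prepend_col w T) = det \<Delta> * det (\<delta> \<cdot>\<^sub>m A)"
    by (simp only:)
  \<comment> \<open>The common factor comes from \<open>det H\<close> on the left and from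
    \<open>\<Delta>\<close> and \<open>\<delta> \<cdot>\<^sub>m A\<close> on the right.\<close>
  then have eq: "(\<delta> ^ k * \<delta>) * det (prepend_col w T) = (\<delta> ^ k * \<delta>) * det A"
    using M A by (simp add: \<Delta>_def \<delta>_def)
  have "\<delta> ^ k * \<delta> \<noteq> 0"
    using nz by (simp add: \<delta>_def)
  then show ?thesis
    by (rule mult_left_cancel[THEN iffD1, OF _ eq])
qed

text \<open>Up to sign, the Cramer numerators of \<open>p\<close> and \<open>q\<close> for a square
  submatrix of \<open>T\<close> are maximal subdeterminants of the two projections, hence bounded by
  1.\<close>

lemma bimodular_if_unimodular_projections:
  fixes T :: "int mat"
  assumes T: "T \<in> carrier_mat (Suc k) n" and p: "p \<in> carrier_vec (Suc k)" and q: "q \<in> carrier_vec (Suc k)"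
    and q0: "q \<noteq> 0\<^sub>v (Suc k)" and pq: "\<And>c. p \<noteq> c \<cdot>\<^sub>v q"
    and p_dets: "\<And>J. J \<subseteq> {..<n} \<Longrightarrow> card J = k \<Longrightarrow> \<bar>det (prepend_col p (cols_submatrix T J))\<bar> \<le> 1"
    and q_dets: "\<And>J. J \<subseteq> {..<n} \<Longrightarrow> card J = k \<Longrightarrow> \<bar>det (prepend_col q (cols_submatrix T J))\<bar> \<le> 1"
    and J: "J \<subseteq> {..<n}" "card J = Suc k"
  shows "\<bar>det (cols_submatrix T J)\<bar> \<le> 2"
proof (rule abs_det_le_2_if_cramer_numerators[OF _ p q q0 pq])
  let ?M = "cols_submatrix T J"
  show M: "?M \<in> carrier_mat (Suc k) (Suc k)"
    using T J dim_cols_submatrix[of J T] by auto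
  have bij: "bij_betw (pick J) {..<Suc k} J"
    using bij_betw_pick[of J] J finite_subset[OF J(1)] by simp
  have *: "\<exists>J'\<subseteq>{..<n}. card J' = k \<and> \<bar>det (replace_col ?M w e)\<bar> = \<bar>det (prepend_col w (cols_submatrix T J'))\<bar>"
    if e: "e < Suc k" for w e
  proof -
    \<comment> \<open>The increasing enumeration of \<open>J\<close> without its element at position
      \<open>e\<close>.\<close>
    define h where "h = pick J \<circ> insert_index e"
    have mono: "strict_mono_on {..<k} h"
      using J by (auto intro!: strict_mono_onI pick_mono_le simp: h_def insert_index_def simp del: pick.simps)
    have sub: "h ` {..<k} \<subseteq> {..<n}"
      using J bij by (auto simp: h_def insert_index_def bij_betw_def)
    have "select_cols ?M k (insert_index e) = select_cols T k h"
      using T J e by (auto simp: cols_submatrix_eq_select_cols h_def insert_index_def intro!: eq_matI)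
    also have "\<dots> = cols_submatrix T (h ` {..<k})"
      using T by (intro select_cols_strict_mono[OF mono]) (use sub in auto)
    finally have "\<bar>det (replace_col ?M w e)\<bar> = \<bar>det (prepend_col w (cols_submatrix T (h ` {..<k})))\<bar>"
      by (simp add: det_replace_col[OF M e] abs_mult power_abs)
    moreover have "card (h ` {..<k}) = k"
      using strict_mono_on_imp_inj_on[OF mono] by (simp add: card_image)
    ultimately show ?thesis
      using sub by blast
  qed
  show "\<bar>det (replace_col ?M p e)\<bar> \<le> 1" if "e < Suc k" for e
    using *[OF that, of p] p_dets by auto
  show "\<bar>det (replace_col ?M q e)\<bar> \<le> 1" if "e < Suc k" for e
    using *[OF that, of q] q_dets by auto
qed

text \<open>The selection \<open>g\<close> witnesses the full row rank of \<open>T\<close>; the zero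
  pattern of \<open>q\<close> and the non-zero entry of \<open>p\<close> will show that they are
  non-parallel.\<close>

lemma S_modular_imp_lift:
  fixes A :: "int poly mat"
  assumes A: "A \<in> carrier_mat k n" and f: "f ` {..<k} \<subseteq> {..<n}"
    and S: "\<And>g. g ` {..<k} \<subseteq> {..<n} \<Longrightarrow>
      \<exists>a b. \<bar>a\<bar> \<le> 1 \<and> \<bar>b\<bar> \<le> 1 \<and> det (select_cols A k g) = [:b, a + b:]"
    and b: "poly (det (select_cols A k f)) 0 \<noteq> 0"
    and indep: "\<And>c. \<exists>J\<subseteq>{..<n}. card J = k \<and> det (cols_submatrix A J) \<notin> {0, c, - c}"
  obtains T :: "int mat" and p q :: "int vec" and g where
    "T \<in> carrier_mat (Suc k) n" "p \<in> carrier_vec (Suc k)" "q \<in> carrier_vec (Suc k)"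
    "g ` {..<Suc k} \<subseteq> {..<n}" "det (select_cols T (Suc k) g) \<noteq> 0"
    "q $ 0 \<noteq> 0" "\<And>i. i < k \<Longrightarrow> q $ Suc i = 0" "\<exists>i<k. p $ Suc i \<noteq> 0"
    "\<And>J. J \<subseteq> {..<n} \<Longrightarrow> card J = k \<Longrightarrow>
      det (prepend_col (var_x \<cdot>\<^sub>v map_vec of_int p + (var_x + 1) \<cdot>\<^sub>v map_vec of_int q)
        (map_mat of_int (cols_submatrix T J))) = det (cols_submatrix A J)"
proof -
  define M where "M = select_cols A k f"
  have M: "M \<in> carrier_mat k k"
    using A by (auto simp: M_def)
  obtain a b where ab: "\<bar>a\<bar> \<le> 1" "\<bar>b\<bar> \<le> 1" "det M = [:b, a + b:]"
    using S[OF f] by (auto simp: M_def)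
  then have "b = 1 \<or> b = -1"
    using b by (auto simp: M_def)
  then have bb: "b * b = 1" "b \<noteq> 0" by auto
  have detM: "det M \<noteq> 0"
    using ab bb by simp
  obtain E N :: "nat \<Rightarrow> nat \<Rightarrow> int" where
    D: "\<And>i j. i < k \<Longrightarrow> j < n \<Longrightarrow>
      det (select_cols A k (f(i := j))) = var_x * of_int (E i j) + det M * of_int (N i j)" and
    E_le: "\<And>i j. i < k \<Longrightarrow> j < n \<Longrightarrow> \<bar>E i j\<bar> \<le> 2" and
    E_minor: "\<And>i i' j l. i < k \<Longrightarrow> i' < k \<Longrightarrow> j < n \<Longrightarrow> l < n \<Longrightarrow> E i j * E i' l = E i l * E i' j"
    using exchange_matrix_decomposition[OF A f S ab(3)[unfolded M_def] ab(1) bb(1)]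
    unfolding ab(3) by blast
  have adj: "(adj_mat M * cols_submatrix A J) $$ (i, l) = det M * of_int (N i (pick J l)) + var_x * of_int (E i (pick J l))"
    if J: "J \<subseteq> {..<n}" "card J = k" and "i < k" "l < k" for J i l
  proof -
    have jn: "pick J l < n"
      using pick_in_set_le[of l J] that by auto
    have "col (cols_submatrix A J) l = col A (pick J l)"
      using A J that jn by (simp add: cols_submatrix_eq_select_cols col_select_cols)
    then have "(adj_mat M * cols_submatrix A J) $$ (i, l) = (adj_mat M *\<^sub>v col A (pick J l)) $ i"
      using adj_mat(1)[OF M] A J that dim_cols_submatrix[of J A] by simp
    also have "\<dots> = det (select_cols A k (f(i := pick J l)))"
      using A that jn adj_mat_mult_vec_index[OF M, of "col A (pick J l)" i]
      by (auto simp: M_def replace_col_select_cols)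
    finally show ?thesis
      using D[OF that(3) jn] by simp
  qed
  \<comment> \<open>If \<open>E\<close> vanished, each maximal subdeterminant would be
    \<open>det M\<close> times an integer \<open>det NJ\<close>. The coordinate bounds force that
    integer into {-1, 0, 1}, against \<open>indep\<close> for \<open>det M\<close>.\<close>
  have "\<exists>i1<k. \<exists>j1<n. E i1 j1 \<noteq> 0"
  proof (rule ccontr)
    assume "\<not> ?thesis"
    then have E0: "E i j = 0" if "i < k" "j < n" for i j
      using that by auto
    have "det (cols_submatrix A J) \<in> {0, det M, - det M}" if J: "J \<subseteq> {..<n}" "card J = k" for J
    proof -
      define NJ where "NJ = mat k k (\<lambda>(i, l). N i (pick J l))"
      have NJ: "NJ \<in> carrier_mat k k" "map_mat of_int NJ \<in> carrier_mat k k"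
        by (auto simp: NJ_def)
      have AJ: "cols_submatrix A J \<in> carrier_mat k k"
        using A J dim_cols_submatrix[of J A] by auto
      have jn: "pick J l < n" if "l < k" for l
        using pick_in_set_le[of l J] that J by auto
      have "adj_mat M * cols_submatrix A J = det M \<cdot>\<^sub>m map_mat of_int NJ"
      proof (rule eq_matI)
        fix i l assume "i < dim_row (det M \<cdot>\<^sub>m map_mat of_int NJ)" "l < dim_col (det M \<cdot>\<^sub>m map_mat of_int NJ)"
        then have il: "i < k" "l < k" by (auto simp: NJ_def)
        show "(adj_mat M * cols_submatrix A J) $$ (i, l) = (det M \<cdot>\<^sub>m map_mat of_int NJ) $$ (i, l)"
          unfolding adj[OF J il] using il by (simp add: E0 jn NJ_def)
      qed (use adj_mat(1)[OF M] AJ in \<open>auto simp: NJ_def\<close>)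
      then have "M * (adj_mat M * cols_submatrix A J) = M * (det M \<cdot>\<^sub>m map_mat of_int NJ)"
        by simp
      moreover have "M * (adj_mat M * cols_submatrix A J) = det M \<cdot>\<^sub>m cols_submatrix A J"
        using adj_mat[OF M] M AJ
        by (simp add: mult_smult_assoc_mat[of _ k k _ k] flip: assoc_mult_mat[of _ k k _ k _ k])
      ultimately have "det M \<cdot>\<^sub>m cols_submatrix A J = det M \<cdot>\<^sub>m (M * map_mat of_int NJ)"
        using M NJ by (simp add: mult_smult_distrib[of _ k k _ k])
      then have "det (det M \<cdot>\<^sub>m cols_submatrix A J) = det (det M \<cdot>\<^sub>m (M * map_mat of_int NJ))"
        by simp
      then have P: "det (cols_submatrix A J) = det M * of_int (det NJ)"
        using AJ M NJ detM by (simp add: det_mult[of _ k])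
      have "\<exists>a' b'. \<bar>a'\<bar> \<le> 1 \<and> \<bar>b'\<bar> \<le> 1 \<and> det (cols_submatrix A J) = [:b', a' + b':]"
        using A J S[of "pick J"] pick_in_set_le[of _ J] by (auto simp: cols_submatrix_eq_select_cols)
      then have "\<bar>b * det NJ\<bar> \<le> 1"
        using P ab(3) by (auto simp: of_int_poly mult.commute)
      then have "\<bar>det NJ\<bar> \<le> 1"
        using \<open>b = 1 \<or> b = -1\<close> by auto
      then have "det NJ \<in> {-1, 0, 1}" by auto
      then show ?thesis
        using P by auto
    qed
    then show False
      using indep[of "det M"] by blast
  qed
  then obtain i1 j1 where ij1: "i1 < k" "j1 < n" "E i1 j1 \<noteq> 0" by blast
  have "\<exists>u i0. i0 < k \<and> u i0 = 1 \<and> E i0 j1 \<noteq> 0 \<and> (\<forall>i<k. \<forall>j<n. E i j = u i * E i0 j)"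
    by (rule rank_one_factorization[where E = E, OF _ _ ij1]) (fact E_minor, fact E_le)
  then obtain u i0 where u: "i0 < k" "u i0 = 1" "E i0 j1 \<noteq> 0"
    "\<forall>i<k. \<forall>j<n. E i j = u i * E i0 j"
    by (elim exE conjE)
  \<comment> \<open>Row \<open>i0\<close> of \<open>E\<close> serves as the top row, and
    \<open>u i0 = 1\<close> makes entry \<open>Suc i0\<close> of \<open>p\<close> non-zero.\<close>
  define T where "T = mat (Suc k) n (\<lambda>(i, j). if i = 0 then E i0 j else N (i - 1) j)"
  define p where "p = vec (Suc k) (\<lambda>i. if i = 0 then a else - u (i - 1))"
  define q where "q = vec (Suc k) (\<lambda>i. if i = 0 then b else 0)"
  \<comment> \<open>Column \<open>j1\<close>, where the top row is non-zero, followed by the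
    selection \<open>f\<close> makes the chosen part of \<open>T\<close> lower triangular.\<close>
  define g where "g l = (if l = 0 then j1 else f (l - 1))" for l
  show thesis
  proof (rule that[of T p q g])
    show "T \<in> carrier_mat (Suc k) n" "p \<in> carrier_vec (Suc k)" "q \<in> carrier_vec (Suc k)"
      by (auto simp: T_def p_def q_def)
    show "q $ 0 \<noteq> 0" "\<And>i. i < k \<Longrightarrow> q $ Suc i = 0" "\<exists>i<k. p $ Suc i \<noteq> 0"
      using bb u by (auto simp: q_def p_def intro!: exI[of _ i0])
    show g: "g ` {..<Suc k} \<subseteq> {..<n}"
      using f ij1 by (auto simp: g_def image_subset_iff)
    have gn: "g l < n" if "l < Suc k" for l
      using g that by auto
    \<comment> \<open>Putting \<open>f l\<close> in place \<open>i\<close> leaves the selection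
      unchanged if \<open>i = l\<close> and repeats a column otherwise. So on the selected columns
      \<open>N\<close> is the identity and \<open>E\<close> is zero.\<close>
    have EN: "E i (f l) = 0 \<and> N i (f l) = (if i = l then 1 else 0)" if "i < k" "l < k" for i l
    proof -
      have fl: "f l < n"
        using f that by auto
      have "det (select_cols A k (f(i := f l))) = (if i = l then det M else 0)"
      proof (cases "i = l")
        case False
        then have "\<not> inj_on (f(i := f l)) {..<k}"
          using that by (auto simp: inj_on_def)
        then show ?thesis
          using det_select_cols_not_inj[of A k] A False by auto
      qed (simp add: M_def fun_upd_idem)
      then have eq: "var_x * of_int (E i (f l)) + [:b, a + b:] * of_int (N i (f l)) = (if i = l then [:b, a + b:] else 0)"
        using D[OF that(1) fl] ab(3) by simp
      have "b * N i (f l) = (if i = l then b else 0)"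
        using arg_cong[OF eq, of "\<lambda>s. poly s 0"] by (auto simp: of_int_poly split: if_splits)
      then have N: "N i (f l) = (if i = l then 1 else 0)"
        using bb by (auto split: if_splits)
      moreover have "E i (f l) = 0"
        using eq unfolding N by (auto simp: of_int_poly split: if_splits)
      ultimately show ?thesis by simp
    qed
    have "det (select_cols T (Suc k) g) = prod_list (diag_mat (select_cols T (Suc k) g))"
    proof (rule det_lower_triangular)
      show "select_cols T (Suc k) g \<in> carrier_mat (Suc k) (Suc k)"
        by (auto simp: T_def)
      show "select_cols T (Suc k) g $$ (i, j) = 0" if "i < j" "j < Suc k" for i j
        using that gn[of j] EN u(1) by (auto simp: T_def g_def)
    qed
    also have "\<dots> = (\<Prod>i = 0..<Suc k. select_cols T (Suc k) g $$ (i, i))"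
      by (simp add: prod_list_diag_prod T_def)
    also have "\<dots> = (\<Prod>i = 0..<Suc k. if i = 0 then E i0 j1 else 1)"
      using gn EN by (intro prod.cong) (auto simp: T_def g_def)
    finally show "det (select_cols T (Suc k) g) \<noteq> 0"
      using u(3) by (auto simp: prod_zero_iff)
    fix J assume J: "J \<subseteq> {..<n}" "card J = k"
    let ?w = "var_x \<cdot>\<^sub>v map_vec of_int p + (var_x + 1) \<cdot>\<^sub>v map_vec of_int q"
    have TJ: "cols_submatrix T J = select_cols T k (pick J)"
      using J by (simp add: cols_submatrix_eq_select_cols T_def)
    have jn: "pick J l < n" if "l < k" for l
      using pick_in_set_le[of l J] that J by auto
    show "det (prepend_col ?w (map_mat of_int (cols_submatrix T J))) = det (cols_submatrix A J)"
    proof (rule det_prepend_col_lift[OF M _ _ detM])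
      show "cols_submatrix A J \<in> carrier_mat k k"
        using A J dim_cols_submatrix[of J A] by auto
      show "map_mat of_int (cols_submatrix T J) \<in> carrier_mat (Suc k) k"
        unfolding TJ by (auto simp: T_def)
      show "?w \<in> carrier_vec (Suc k)"
        by (auto simp: p_def q_def)
      \<comment> \<open>The top entry is a x + b (x + 1); the entries below are \<open>- u i\<close>
        times x, which turns \<open>adj\<close> into the last premise of
        \<open>det_prepend_col_lift\<close>.\<close>
      show "?w $ 0 = det M"
        by (simp add: p_def q_def ab(3) int_poly_eq_coordinates del: pCons_eq_iff)
      fix i l assume il: "i < k" "l < k"
      show "(adj_mat M * cols_submatrix A J) $$ (i, l) =
          det M * map_mat of_int (cols_submatrix T J) $$ (Suc i, l) -
          ?w $ Suc i * map_mat of_int (cols_submatrix T J) $$ (0, l)"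
        unfolding TJ adj[OF J il] u(4)[rule_format, OF il(1) jn[OF il(2)]] using il jn[OF il(2)]
        by (simp add: T_def p_def q_def)
    qed
  qed
qed

subsection \<open>Projections\<close>

lemma det_map_mat_poly: "det (map_mat (\<lambda>s. poly s c) M) = poly (det M) c"
  for c :: "'a::comm_ring_1"
  by (rule comm_ring_hom.hom_det) (unfold_locales, auto)

text \<open>The non-zero minor at \<open>J\<^sub>0\<close> supplies the full row rank in
  \<open>unimodular\<close>; the determinants are transported along the embedding of the integers
  into the rational functions.\<close>

lemma integral_projection:
  fixes T B :: "int mat" and w :: "int vec"
  assumes T: "T \<in> carrier_mat (Suc k) n" "full_row_rank (int_mat_to_ratfun T)" and kn: "1 \<le> k" "2 \<le> n"
    and w: "w \<in> carrier_vec (Suc k)" "w \<noteq> 0\<^sub>v (Suc k)" and B: "B \<in> carrier_mat k n"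
    and dets: "\<And>J. J \<subseteq> {..<n} \<Longrightarrow> card J = k \<Longrightarrow>
      det (cols_submatrix B J) = det (prepend_col w (cols_submatrix T J))"
    and le: "\<And>J. J \<subseteq> {..<n} \<Longrightarrow> card J = k \<Longrightarrow> \<bar>det (cols_submatrix B J)\<bar> \<le> 1"
    and nz: "J\<^sub>0 \<subseteq> {..<n}" "card J\<^sub>0 = k" "det (cols_submatrix B J\<^sub>0) \<noteq> 0"
  shows "is_projection (int_mat_to_ratfun T) (int_vec_to_ratfun w) (int_mat_to_ratfun B)"
    and "unimodular (int_mat_to_ratfun B)"
proof -
  have detB: "det (cols_submatrix (int_mat_to_ratfun B) J) = of_int (det (cols_submatrix B J))"
    if "J \<subseteq> {..<n}" for J
    using that B by (simp add: cols_submatrix_map_mat)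
  have "det (cols_submatrix (int_mat_to_ratfun B) J) =
      det (prepend_col (int_vec_to_ratfun w) (cols_submatrix (int_mat_to_ratfun T) J))"
    if J: "J \<subseteq> {..<n}" "card J = k" for J
    using T w dim_cols_submatrix[of J T] J
    by (simp add: detB dets cols_submatrix_map_mat prepend_col_map_mat)
  moreover have "int_vec_to_ratfun w \<noteq> 0\<^sub>v (Suc k)"
  proof
    assume "int_vec_to_ratfun w = 0\<^sub>v (Suc k)"
    then have "w $ i = 0" if "i < Suc k" for i
      using that w(1) arg_cong[of _ _ "\<lambda>v. v $ i"] by fastforce
    then have "w = 0\<^sub>v (Suc k)"
      using w(1) by (intro eq_vecI) auto
    with w(2) show False by simp
  qed
  ultimately show "is_projection (int_mat_to_ratfun T) (int_vec_to_ratfun w) (int_mat_to_ratfun B)"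
    using T kn w B by (auto simp: is_projection_def)
  have "full_row_rank (int_mat_to_ratfun B)"
    using full_row_rank_if_minor[of J\<^sub>0 "int_mat_to_ratfun B"] nz B detB[OF nz(1)] by simp
  moreover have "S_modular {-1, 0, 1} (int_mat_to_ratfun B)"
  proof -
    have "of_int (det (cols_submatrix B J)) \<in> {-1, 0, 1 :: ratfun}" if J: "J \<subseteq> {..<n}" "card J = k" for J
    proof -
      have "det (cols_submatrix B J) \<in> {-1, 0, 1}"
        using le[OF J] by auto
      then show ?thesis by auto
    qed
    then have "det (cols_submatrix (int_mat_to_ratfun B) J) \<in> {-1, 0, 1}" if "J \<subseteq> {..<n}" "card J = k" for J
      using that detB by metis
    moreover have "dim_row (int_mat_to_ratfun B) = k" "dim_col (int_mat_to_ratfun B) = n"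
      using B by auto
    ultimately show ?thesis
      unfolding S_modular_def max_subdets_def by blast
  qed
  ultimately show "unimodular (int_mat_to_ratfun B)"
    by (simp add: unimodular_def)
qed

lemma mem_plus_minus_iff:
  "s \<in> plus_minus {0, 1, var_x, var_x + 1, 2 * var_x + 1} \<longleftrightarrow>
    (\<exists>a b. \<bar>a\<bar> \<le> 1 \<and> \<bar>b\<bar> \<le> 1 \<and> s = [:b, a + b:])"
proof -
  have "{-1, 0, 1} = {a :: int. \<bar>a\<bar> \<le> 1}"
    by auto
  then show ?thesis
    unfolding plus_minus_coordinates by (simp only: image_iff Bex_def) auto
qed

text \<open>By linearity, the subdeterminants of \<open>B\<close> and \<open>C\<close> are the
  coordinates of those of \<open>A\<close> with respect to x and x + 1.\<close>

lemma projections_imp_S_modular: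
  fixes A :: "int poly mat" and T :: "int mat" and p q :: "int vec"
  assumes p: "p \<in> carrier_vec (dim_row T)" and q: "q \<in> carrier_vec (dim_row T)"
    and P: "is_projection (int_mat_to_ratfun T) (int_vec_to_ratfun p) B" "unimodular B"
    and Q: "is_projection (int_mat_to_ratfun T) (int_vec_to_ratfun q) C" "unimodular C"
    and W: "is_projection (int_mat_to_ratfun T)
         (to_fract var_x \<cdot>\<^sub>v int_vec_to_ratfun p + to_fract (var_x + 1) \<cdot>\<^sub>v int_vec_to_ratfun q)
         (poly_mat_to_ratfun A)"
  shows "S_modular (plus_minus {0, 1, var_x, var_x + 1, 2 * var_x + 1}) A"
proof -
  define k n where "k = dim_row T - 1" and "n = dim_col T"
  have k: "dim_row T = Suc k"
    using W by (auto simp: is_projection_def k_def)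
  have A: "A \<in> carrier_mat k n"
    using W by (auto simp: is_projection_def k_def n_def)
  have unimodular_det: "\<exists>a::int. \<bar>a\<bar> \<le> 1 \<and> det (prepend_col (int_vec_to_ratfun w) (cols_submatrix (int_mat_to_ratfun T) J)) = of_int a"
    if B: "is_projection (int_mat_to_ratfun T) (int_vec_to_ratfun w) B" "unimodular B"
      and J: "J \<subseteq> {..<n}" "card J = k" for w B J
  proof -
    have "dim_row B = k" "dim_col B = n"
      using B(1) by (auto simp: is_projection_def k_def n_def)
    then have "det (cols_submatrix B J) \<in> max_subdets B"
      using J unfolding max_subdets_def by blast
    then have "det (cols_submatrix B J) \<in> {-1, 0, 1}"
      using B(2) by (auto simp: unimodular_def S_modular_def)
    then have "det (cols_submatrix B J) \<in> of_int ` {-1, 0, 1 :: int}"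
      by auto
    then obtain a :: int where a: "a \<in> {-1, 0, 1}" "det (cols_submatrix B J) = of_int a"
      by blast
    moreover have "\<bar>a\<bar> \<le> 1"
      using a(1) by auto
    moreover have "det (cols_submatrix B J) = det (prepend_col (int_vec_to_ratfun w) (cols_submatrix (int_mat_to_ratfun T) J))"
      using B(1) J by (auto simp: is_projection_def k_def n_def)
    ultimately show ?thesis
      by metis
  qed
  have "det (cols_submatrix A J) \<in> plus_minus {0, 1, var_x, var_x + 1, 2 * var_x + 1}"
    if J: "J \<subseteq> {..<n}" "card J = k" for J
  proof -
    let ?TJ = "cols_submatrix (int_mat_to_ratfun T) J"
    have TJ: "?TJ \<in> carrier_mat (Suc k) k"
      using dim_cols_submatrix[of J "int_mat_to_ratfun T"] J k by (auto simp: n_def)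
    obtain a where a: "\<bar>a\<bar> \<le> 1" "det (prepend_col (int_vec_to_ratfun p) ?TJ) = of_int a"
      using unimodular_det[OF P J] by blast
    obtain b where b: "\<bar>b\<bar> \<le> 1" "det (prepend_col (int_vec_to_ratfun q) ?TJ) = of_int b"
      using unimodular_det[OF Q J] by blast
    have "to_fract (det (cols_submatrix A J)) = det (cols_submatrix (poly_mat_to_ratfun A) J)"
      using A J by (simp add: cols_submatrix_map_mat)
    also have "\<dots> = det (prepend_col (to_fract var_x \<cdot>\<^sub>v int_vec_to_ratfun p + to_fract (var_x + 1) \<cdot>\<^sub>v int_vec_to_ratfun q) ?TJ)"
      using W J by (auto simp: is_projection_def k_def n_def)
    also have "\<dots> = to_fract var_x * of_int a + to_fract (var_x + 1) * of_int b"
      using p q k by (simp only: det_prepend_col_linear[OF TJ] a b map_carrier_vec)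
    also have "\<dots> = to_fract [:b, a + b:]"
      unfolding int_poly_eq_coordinates by (simp only: to_fract_hom.hom_add to_fract_hom.hom_mult to_fract_hom.hom_of_int)
    finally have "det (cols_submatrix A J) = [:b, a + b:]"
      by (simp only: to_fract_hom.eq_iff)
    then show ?thesis
      unfolding mem_plus_minus_iff using a(1) b(1) by blast
  qed
  then show ?thesis
    using A unfolding S_modular_def max_subdets_def by auto
qed

section \<open>Equivalence of S-modularity and the existence of a lift\<close>

theorem theorem4:
  fixes A :: "int poly mat" and S :: "int poly set"
  defines "S \<equiv> plus_minus {0, 1, var_x, var_x + 1, 2 * var_x + 1}"
  assumes "full_row_rank (poly_mat_to_ratfun A)"
    and "\<exists>d\<in>max_subdets A. \<exists>e\<in>max_subdets A. d \<noteq> 0 \<and> e \<noteq> 0 \<and> \<bar>d\<bar> \<noteq> \<bar>e\<bar>"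
  shows "S_modular S A \<longleftrightarrow>
    (\<exists>(T :: int mat) (p :: int vec) (q :: int vec).
       bimodular T \<and>
       p \<in> carrier_vec (dim_row T) \<and> q \<in> carrier_vec (dim_row T) \<and>
       p \<noteq> 0\<^sub>v (dim_row T) \<and> q \<noteq> 0\<^sub>v (dim_row T) \<and> non_parallel (dim_row T) p q \<and>
       (\<exists>B. is_projection (int_mat_to_ratfun T) (int_vec_to_ratfun p) B \<and> unimodular B) \<and>
       (\<exists>B. is_projection (int_mat_to_ratfun T) (int_vec_to_ratfun q) B \<and> unimodular B) \<and>
       is_projection (int_mat_to_ratfun T)
         (to_fract var_x \<cdot>\<^sub>v int_vec_to_ratfun p + to_fract (var_x + 1) \<cdot>\<^sub>v int_vec_to_ratfun q)
         (poly_mat_to_ratfun A))"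
    (is "_ \<longleftrightarrow> ?R")
proof
  assume ?R
  then obtain T p q B C where
    "p \<in> carrier_vec (dim_row T)" "q \<in> carrier_vec (dim_row T)"
    "is_projection (int_mat_to_ratfun T) (int_vec_to_ratfun p) B" "unimodular B"
    "is_projection (int_mat_to_ratfun T) (int_vec_to_ratfun q) C" "unimodular C"
    "is_projection (int_mat_to_ratfun T)
      (to_fract var_x \<cdot>\<^sub>v int_vec_to_ratfun p + to_fract (var_x + 1) \<cdot>\<^sub>v int_vec_to_ratfun q)
      (poly_mat_to_ratfun A)"
    by (elim exE conjE)
  then show "S_modular S A"
    unfolding S_def by (rule projections_imp_S_modular)
next
  assume "S_modular S A"
  define k n where "k = dim_row A" and "n = dim_col A"
  have A: "A \<in> carrier_mat k n"
    by (simp add: k_def n_def)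
  have S_coords: "\<exists>a b. \<bar>a\<bar> \<le> 1 \<and> \<bar>b\<bar> \<le> 1 \<and> s = [:b, a + b:]" if "s \<in> S" for s
    using that unfolding S_def mem_plus_minus_iff .
  \<comment> \<open>Repeated or reordered columns are harmless, as \<open>S\<close> contains 0 and
    is closed under negation.\<close>
  have S: "\<exists>a b. \<bar>a\<bar> \<le> 1 \<and> \<bar>b\<bar> \<le> 1 \<and> det (select_cols A k g) = [:b, a + b:]"
    if "g ` {..<k} \<subseteq> {..<n}" for g
  proof -
    have "det (select_cols A k g) \<in> {0} \<union> max_subdets A \<union> uminus ` max_subdets A"
      using det_select_cols_in_max_subdets[of A k g] that by (simp add: k_def n_def)
    moreover have "max_subdets A \<subseteq> S" "0 \<in> S" "uminus ` S \<subseteq> S"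
      using \<open>S_modular S A\<close> by (auto simp: S_modular_def S_def plus_minus_def)
    ultimately show ?thesis
      by (intro S_coords) auto
  qed
  have coords: "\<exists>a b. \<bar>a\<bar> \<le> 1 \<and> \<bar>b\<bar> \<le> 1 \<and> det (cols_submatrix A J) = [:b, a + b:]"
    if "J \<subseteq> {..<n}" "card J = k" for J
  proof -
    have "det (cols_submatrix A J) \<in> max_subdets A"
      using that unfolding max_subdets_def k_def n_def by blast
    then show ?thesis
      using \<open>S_modular S A\<close> unfolding S_modular_def by (intro S_coords) blast
  qed
  have indep: "\<exists>J\<subseteq>{..<n}. card J = k \<and> det (cols_submatrix A J) \<notin> {0, c, - c}" for c
  proof -
    obtain d e where de: "d \<in> max_subdets A" "e \<in> max_subdets A" "d \<noteq> 0" "e \<noteq> 0" "\<bar>d\<bar> \<noteq> \<bar>e\<bar>"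
      using assms(3) by blast
    then have "d \<notin> {0, c, - c} \<or> e \<notin> {0, c, - c}"
      by auto
    then show ?thesis
      using de(1,2) by (auto simp: max_subdets_def k_def n_def)
  qed
  \<comment> \<open>Taking \<open>c = var_x\<close> in \<open>indep\<close> yields a non-zero
    coordinate along x + 1. This column set starts the lift and gives a non-zero minor of
    \<open>C\<close>.\<close>
  obtain J\<^sub>0 where J0: "J\<^sub>0 \<subseteq> {..<n}" "card J\<^sub>0 = k" "poly (det (cols_submatrix A J\<^sub>0)) 0 \<noteq> 0"
  proof -
    obtain J where J: "J \<subseteq> {..<n}" "card J = k" "det (cols_submatrix A J) \<notin> {0, var_x, - var_x}"
      using indep by blast
    obtain a b where ab: "\<bar>a\<bar> \<le> 1" "det (cols_submatrix A J) = [:b, a + b:]"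
      using coords[OF J(1,2)] by blast
    have "a = -1 \<or> a = 0 \<or> a = 1"
      using ab(1) by linarith
    then have "b \<noteq> 0"
      using J(3) ab(2) by auto
    then show thesis
      using that[OF J(1,2)] ab(2) by simp
  qed
  \<comment> \<open>Likewise, \<open>c = var_x + 1\<close> yields a non-zero minor of
    \<open>B\<close>.\<close>
  obtain J\<^sub>1 where J1: "J\<^sub>1 \<subseteq> {..<n}" "card J\<^sub>1 = k" "poly (det (cols_submatrix A J\<^sub>1)) (-1) \<noteq> 0"
  proof -
    obtain J where J: "J \<subseteq> {..<n}" "card J = k" "det (cols_submatrix A J) \<notin> {0, var_x + 1, - (var_x + 1)}"
      using indep by blast
    obtain a b where ab: "\<bar>b\<bar> \<le> 1" "det (cols_submatrix A J) = [:b, a + b:]"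
      using coords[OF J(1,2)] by blast
    have "b = -1 \<or> b = 0 \<or> b = 1"
      using ab(1) by linarith
    then have "a \<noteq> 0"
      using J(3) ab(2) by (auto simp: pCons_plus_1)
    then show thesis
      using that[OF J(1,2)] ab(2) by simp
  qed
  have J0_select: "cols_submatrix A J\<^sub>0 = select_cols A k (pick J\<^sub>0)" "pick J\<^sub>0 ` {..<k} \<subseteq> {..<n}"
    using J0 A pick_in_set_le[of _ "J\<^sub>0"] by (auto simp: cols_submatrix_eq_select_cols)
  obtain T :: "int mat" and p q :: "int vec" and g where
    T: "T \<in> carrier_mat (Suc k) n" and p: "p \<in> carrier_vec (Suc k)" and q: "q \<in> carrier_vec (Suc k)" and
    g: "g ` {..<Suc k} \<subseteq> {..<n}" "det (select_cols T (Suc k) g) \<noteq> 0" and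
    q0: "q $ 0 \<noteq> 0" and q_Suc: "\<And>i. i < k \<Longrightarrow> q $ Suc i = 0" and "\<exists>i<k. p $ Suc i \<noteq> 0" and
    lift: "\<And>J. J \<subseteq> {..<n} \<Longrightarrow> card J = k \<Longrightarrow>
      det (prepend_col (var_x \<cdot>\<^sub>v map_vec of_int p + (var_x + 1) \<cdot>\<^sub>v map_vec of_int q)
        (map_mat of_int (cols_submatrix T J))) = det (cols_submatrix A J)"
    using S_modular_imp_lift[OF A J0_select(2) S J0(3)[unfolded J0_select(1)] indep] by blast
  then obtain i where i: "i < k" "p $ Suc i \<noteq> 0" by blast
  have dT: "dim_row T = Suc k" "dim_col T = n"
    using T by auto
  have k: "1 \<le> k"
    using i by simp
  have "inj_on g {..<Suc k}"
    using det_select_cols_not_inj[of T "Suc k" g] dT g(2) by auto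
  then have card_g: "card (g ` {..<Suc k}) = Suc k"
    by (simp add: card_image)
  then have n: "2 \<le> n"
    using k card_mono[OF _ g(1)] by simp
  have minor_T: "det (cols_submatrix T (g ` {..<Suc k})) \<noteq> 0"
    using det_select_cols_inj[of T "Suc k" g] dT g \<open>inj_on g {..<Suc k}\<close> by auto
  have rank_rat: "full_row_rank (map_mat rat_of_int T)"
    using full_row_rank_if_minor[of "g ` {..<Suc k}" "map_mat rat_of_int T"] dT g(1) card_g minor_T
    by (simp add: cols_submatrix_map_mat)
  have rank_ratfun: "full_row_rank (int_mat_to_ratfun T)"
    using full_row_rank_if_minor[of "g ` {..<Suc k}" "int_mat_to_ratfun T"] dT g(1) card_g minor_T
    by (simp add: cols_submatrix_map_mat)
  have TJ: "cols_submatrix T J \<in> carrier_mat (Suc k) k" if "J \<subseteq> {..<n}" "card J = k" for J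
    using dim_cols_submatrix[of J T] that dT by auto
  \<comment> \<open>Linearity identifies the coordinates of the subdeterminants of \<open>A\<close>
    with the subdeterminants that T/q and T/p must have.\<close>
  have detA: "det (cols_submatrix A J) =
      [:det (prepend_col q (cols_submatrix T J)),
        det (prepend_col p (cols_submatrix T J)) + det (prepend_col q (cols_submatrix T J)):]"
    if J: "J \<subseteq> {..<n}" "card J = k" for J
  proof -
    have map: "det (prepend_col (map_vec of_int w) (map_mat of_int (cols_submatrix T J)) :: int poly mat) =
        of_int (det (prepend_col w (cols_submatrix T J)))" if "w \<in> carrier_vec (Suc k)" for w
      using TJ[OF J] that by (simp add: prepend_col_map_mat)
    have TJ': "map_mat of_int (cols_submatrix T J) \<in> carrier_mat (Suc k) k"
      using TJ[OF J] by simp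
    show ?thesis
      unfolding int_poly_eq_coordinates lift[OF J, symmetric]
      using p q by (simp only: det_prepend_col_linear[OF TJ'] map map_carrier_vec)
  qed
  have p_det: "det (prepend_col p (cols_submatrix T J)) = - poly (det (cols_submatrix A J)) (-1)"
    and q_det: "det (prepend_col q (cols_submatrix T J)) = poly (det (cols_submatrix A J)) 0"
    and pq_le: "\<bar>det (prepend_col p (cols_submatrix T J))\<bar> \<le> 1" "\<bar>det (prepend_col q (cols_submatrix T J))\<bar> \<le> 1"
    if J: "J \<subseteq> {..<n}" "card J = k" for J
    using detA[OF J] coords[OF J] by auto
  \<comment> \<open>Evaluation at -1 negates the coordinate along x; negating row 0, which exists as
    \<open>1 \<le> k\<close>, restores the sign.\<close>
  define B where "B = multrow 0 (-1) (map_mat (\<lambda>s. poly s (-1)) A)"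
  define C where "C = map_mat (\<lambda>s. poly s 0) A"
  have BC: "B \<in> carrier_mat k n" "C \<in> carrier_mat k n"
    using A by (auto simp: B_def C_def)
  have C_det: "det (cols_submatrix C J) = poly (det (cols_submatrix A J)) 0" if "J \<subseteq> {..<n}" for J
    using that A by (simp add: C_def cols_submatrix_map_mat det_map_mat_poly)
  have B_det: "det (cols_submatrix B J) = - poly (det (cols_submatrix A J)) (-1)"
    if J: "J \<subseteq> {..<n}" "card J = k" for J
  proof -
    let ?X = "map_mat (\<lambda>s. poly s (-1)) A"
    have "pick J l < n" if "l < k" for l
      using pick_in_set_le[of l J] that J by auto
    then have "cols_submatrix B J = multrow 0 (-1) (cols_submatrix ?X J)"
      using A J by (auto simp: B_def cols_submatrix_eq_select_cols intro!: eq_matI)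
    moreover have "cols_submatrix ?X J \<in> carrier_mat k k"
      using A J dim_cols_submatrix[of J ?X] by auto
    ultimately have "det (cols_submatrix B J) = - det (cols_submatrix ?X J)"
      using k by (simp add: det_multrow[of 0 k])
    then show ?thesis
      using A J by (simp add: cols_submatrix_map_mat det_map_mat_poly)
  qed
  have p_nz: "p \<noteq> 0\<^sub>v (Suc k)" and q_nz: "q \<noteq> 0\<^sub>v (Suc k)"
    using i q0 by auto
  have B_eq: "det (cols_submatrix B J) = det (prepend_col p (cols_submatrix T J))"
    and B_le: "\<bar>det (cols_submatrix B J)\<bar> \<le> 1"
    and C_eq: "det (cols_submatrix C J) = det (prepend_col q (cols_submatrix T J))"
    and C_le: "\<bar>det (cols_submatrix C J)\<bar> \<le> 1" if J: "J \<subseteq> {..<n}" "card J = k" for J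
    using B_det[OF J] C_det[OF J(1)] p_det[OF J] q_det[OF J] pq_le[OF J] by simp_all
  have B_nz: "det (cols_submatrix B J\<^sub>1) \<noteq> 0" and C_nz: "det (cols_submatrix C J\<^sub>0) \<noteq> 0"
    using B_det[OF J1(1,2)] C_det[OF J0(1)] J0(3) J1(3) by simp_all
  have P: "\<exists>B. is_projection (int_mat_to_ratfun T) (int_vec_to_ratfun p) B \<and> unimodular B"
    using integral_projection[OF T rank_ratfun k n p p_nz BC(1) B_eq B_le J1(1,2) B_nz] by blast
  have Q: "\<exists>B. is_projection (int_mat_to_ratfun T) (int_vec_to_ratfun q) B \<and> unimodular B"
    using integral_projection[OF T rank_ratfun k n q q_nz BC(2) C_eq C_le J0(1,2) C_nz] by blast
  have W: "is_projection (int_mat_to_ratfun T)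
      (to_fract var_x \<cdot>\<^sub>v int_vec_to_ratfun p + to_fract (var_x + 1) \<cdot>\<^sub>v int_vec_to_ratfun q)
      (poly_mat_to_ratfun A)" (is "is_projection _ ?w _")
  proof -
    \<comment> \<open>Only \<open>p\<close> contributes at this position, so its non-zero entry
      shows that the vector is non-zero.\<close>
    have "?w $ Suc i = to_fract var_x * of_int (p $ Suc i)"
      using i p q q_Suc by simp
    then have "?w $ Suc i \<noteq> 0"
      using i by (simp add: to_fract_eq_0_iff)
    moreover have "0\<^sub>v (Suc k) $ Suc i = (0 :: ratfun)"
      using i by simp
    ultimately have w: "?w \<noteq> 0\<^sub>v (Suc k)"
      by metis
    have w_carr: "?w \<in> carrier_vec (Suc k)"
      using p q by simp
    have dims: "dim_row (int_mat_to_ratfun T) = Suc k" "dim_col (int_mat_to_ratfun T) = n"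
      using dT by simp_all
    have eq: "det (cols_submatrix (poly_mat_to_ratfun A) J) = det (prepend_col ?w (cols_submatrix (int_mat_to_ratfun T) J))"
      if J: "J \<subseteq> {..<n}" "card J = k" for J
    proof -
      have map: "det (prepend_col (int_vec_to_ratfun v) (cols_submatrix (int_mat_to_ratfun T) J)) =
          of_int (det (prepend_col v (cols_submatrix T J)))" if "v \<in> carrier_vec (Suc k)" for v
        using TJ[OF J] dT J that by (simp add: prepend_col_map_mat cols_submatrix_map_mat)
      have TJ': "cols_submatrix (int_mat_to_ratfun T) J \<in> carrier_mat (Suc k) k"
        using TJ[OF J] dT J by (simp add: cols_submatrix_map_mat)
      have "det (cols_submatrix (poly_mat_to_ratfun A) J) = to_fract (det (cols_submatrix A J))"
        using A J by (simp add: cols_submatrix_map_mat)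
      also have "\<dots> = to_fract var_x * of_int (det (prepend_col p (cols_submatrix T J))) +
          to_fract (var_x + 1) * of_int (det (prepend_col q (cols_submatrix T J)))"
        unfolding detA[OF J] int_poly_eq_coordinates
        by (simp only: to_fract_hom.hom_add to_fract_hom.hom_mult to_fract_hom.hom_of_int)
      also have "\<dots> = det (prepend_col ?w (cols_submatrix (int_mat_to_ratfun T) J))"
        using p q by (simp only: det_prepend_col_linear[OF TJ'] map map_carrier_vec)
      finally show ?thesis .
    qed
    show ?thesis
      unfolding is_projection_def dims diff_Suc_1
    proof (intro conjI allI impI)
      show "poly_mat_to_ratfun A \<in> carrier_mat k n" "2 \<le> Suc k"
        using A k by simp_all
      show "det (cols_submatrix (poly_mat_to_ratfun A) I) = det (prepend_col ?w (cols_submatrix (int_mat_to_ratfun T) I))"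
        if "I \<subseteq> {..<n} \<and> card I = k" for I
        using that by (elim conjE) (rule eq)
    qed (fact n rank_ratfun w w_carr)+
  qed
  have npar: "non_parallel (Suc k) p q"
  proof (rule non_parallelI[OF p q])
    fix s t :: rat
    assume st: "\<And>j. j < Suc k \<Longrightarrow> s * of_int (p $ j) + t * of_int (q $ j) = 0"
    \<comment> \<open>Position \<open>Suc i\<close>, where \<open>q\<close> vanishes, gives
      \<open>s = 0\<close>; position 0 then gives \<open>t = 0\<close>.\<close>
    have "s = 0"
      using st[of "Suc i"] i q_Suc[OF i(1)] by simp
    then show "s = 0 \<and> t = 0"
      using st[of 0] q0 by simp
  qed
  have bim: "bimodular T"
  proof -
    have not_multiple: "p \<noteq> c \<cdot>\<^sub>v q" for c
    proof
      assume "p = c \<cdot>\<^sub>v q"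
      then have "p $ Suc i = (c \<cdot>\<^sub>v q) $ Suc i"
        by (rule arg_cong)
      then show False
        using i q q_Suc[OF i(1)] by simp
    qed
    have "det (cols_submatrix T J) \<in> {-2, -1, 0, 1, 2}" if "J \<subseteq> {..<n}" "card J = Suc k" for J
    proof -
      have "\<bar>det (cols_submatrix T J)\<bar> \<le> 2"
        by (rule bimodular_if_unimodular_projections[OF T p q q_nz not_multiple pq_le that])
      then show ?thesis
        unfolding insert_iff empty_iff by linarith
    qed
    then show ?thesis
      using rank_rat unfolding bimodular_def S_modular_def max_subdets_def dT by blast
  qed
  have "p \<in> carrier_vec (dim_row T)" "q \<in> carrier_vec (dim_row T)"
    "p \<noteq> 0\<^sub>v (dim_row T)" "q \<noteq> 0\<^sub>v (dim_row T)" "non_parallel (dim_row T) p q"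
    unfolding dT by (fact p q p_nz q_nz npar)+
  with bim P Q W show ?R
    by (intro exI[of _ T] exI[of _ p] exI[of _ q] conjI)
qed

end
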